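(* Let $\mathbb{K}$ be an algebraically closed field of characteristic zero, let $m$ be a positive integer and let $d_1,\dots,d_m\in\mathbb{Z}_{\ge 0}$. Then the subgroup $\langle H_1,K_{d_1},\ldots,K_{d_m}\rangle$ of $\mathrm{Aut}(\mathbb{A}^2)$ acts on $\mathbb{A}^2\setminus\{0\}$ infinitely transitively if and only if $\gcd(d_1-1,\ldots,d_m-1)=1$.
   Context: $\mathbb{A}^2$ is the affine plane over $\mathbb{K}$ with coordinates $(x,y)$, $0$ denotes the origin, and $\mathrm{Aut}(\mathbb{A}^2)$ is its group of polynomial automorphisms. For $a,b\in\mathbb{Z}_{\ge 0}$, $H_a$ is the one-parameter subgroup of $\mathrm{Aut}(\mathbb{A}^2)$ consisting of all maps $(x,y)\mapsto(x+\alpha y^a,\,y)$, $\alpha\in\mathbb{K}$, and $K_b$ is the one consisting of all maps $(x,y)\mapsto(x,\,y+\beta x^b)$, $\beta\in\mathbb{K}$. $\langle\cdots\rangle$ denotes the subgroup generated (as an abstract group). A group $G$ acts on a set $X$ infinitely transitively if for every positive integer $n$ and any two tuples $(p_1,\dots,p_n)$, $(q_1,\dots,q_n)$, each consisting of pairwise distinct points of $X$, there is $g\in G$ with $g\cdot p_i=q_i$ for all $i=1,\dots,n$. Convention: $\gcd(0,\dots,0)=0$.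
   Formalization: The formal theorem assumes that the group acts on the plane minus the origin, i.e. that every d_i is at least 1; if some d_i = 0, then K_0 consists of translations moving the origin and the gcd is 1, so the claim fails as stated. *)

theory Defs
  imports
    "HOL-Computational_Algebra.Polynomial"
    "HOL-Algebra.Elementary_Groups"
    "HOL-Algebra.Group_Action"
begin

text \<open>
  Points of the affine plane over a field are pairs. A polynomial in two variables is an element
  \<open>p\<close> of \<open>K[x][y]\<close>, i.e. of type \<open>'a poly poly\<close>, evaluated first at \<open>y\<close> (as a constant polynomial
  in \<open>x\<close>) and then at \<open>x\<close>. Polynomial maps are represented by the functions they induce, which
  loses nothing over an infinite field.
\<close>

definition polynomial_function :: "('a::field \<times> 'a \<Rightarrow> 'a) \<Rightarrow> bool" where
  "polynomial_function f \<longleftrightarrow> (\<exists>p :: 'a poly poly. \<forall>x y. f (x, y) = poly (poly p [:y:]) x)"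

definition polynomial_map :: "('a::field \<times> 'a \<Rightarrow> 'a \<times> 'a) \<Rightarrow> bool" where
  "polynomial_map f \<longleftrightarrow> polynomial_function (\<lambda>v. fst (f v)) \<and> polynomial_function (\<lambda>v. snd (f v))"

definition polynomial_automorphism :: "('a::field \<times> 'a \<Rightarrow> 'a \<times> 'a) \<Rightarrow> bool" where
  "polynomial_automorphism f \<longleftrightarrow>
     polynomial_map f \<and> (\<exists>g. polynomial_map g \<and> g \<circ> f = id \<and> f \<circ> g = id)"

definition Aut_plane :: "('a::field \<times> 'a \<Rightarrow> 'a \<times> 'a) monoid" where
  "Aut_plane = \<lparr>carrier = {f. polynomial_automorphism f}, mult = (\<circ>), one = id\<rparr>"

definition H :: "nat \<Rightarrow> ('a::field \<times> 'a \<Rightarrow> 'a \<times> 'a) set" where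
  "H a = {(\<lambda>(x, y). (x + \<alpha> * y ^ a, y)) | \<alpha>. True}"

definition K :: "nat \<Rightarrow> ('a::field \<times> 'a \<Rightarrow> 'a \<times> 'a) set" where
  "K b = {(\<lambda>(x, y). (x, y + \<beta> * x ^ b)) | \<beta>. True}"

definition punctured_plane :: "('a::field \<times> 'a) set" where
  "punctured_plane = UNIV - {(0, 0)}"

text \<open>
  Group actions in \<^locale>\<open>group_action\<close> are homomorphisms into \<^term>\<open>BijGroup E\<close>, whose
  elements are extensional functions on \<open>E\<close>; a group of self-maps of a larger set therefore acts
  on \<open>E\<close> through \<^term>\<open>\<lambda>g. restrict g E\<close>.
\<close>

locale infinitely_transitive_action = group_action +
  assumes infinitely_transitive:
    "\<lbrakk> n > 0; inj_on p {1..n}; p ` {1..n} \<subseteq> E; inj_on q {1..n}; q ` {1..n} \<subseteq> E \<rbrakk>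
      \<Longrightarrow> \<exists>g \<in> carrier G. \<forall>i \<in> {1..n::nat}. (\<phi> g) (p i) = q i"


subsection \<open>The automorphism group and its subgroups\<close>

lemma polynomial_function_const: "polynomial_function (\<lambda>_. c)"
  unfolding polynomial_function_def by (rule exI[of _ "[:[:c:]:]"]) simp

lemma polynomial_function_fst: "polynomial_function fst"
  unfolding polynomial_function_def by (rule exI[of _ "[:[:0, 1:]:]"]) simp

lemma polynomial_function_snd: "polynomial_function snd"
  unfolding polynomial_function_def by (rule exI[of _ "[:0, 1:]"]) simp

lemma polynomial_function_add:
  assumes "polynomial_function f" "polynomial_function g"
  shows "polynomial_function (\<lambda>v. f v + g v)"
  using assms unfolding polynomial_function_def by (metis poly_add)

lemma polynomial_function_mult:
  assumes "polynomial_function f" "polynomial_function g"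
  shows "polynomial_function (\<lambda>v. f v * g v)"
  using assms unfolding polynomial_function_def by (metis poly_mult)

lemma polynomial_function_power:
  assumes "polynomial_function f"
  shows "polynomial_function (\<lambda>v. f v ^ n)"
  by (induction n) (simp_all add: polynomial_function_const polynomial_function_mult assms)

lemma polynomial_function_poly:
  assumes "polynomial_function f"
  shows "polynomial_function (\<lambda>v. poly p (f v))"
  by (induction p)
    (simp_all add: polynomial_function_const polynomial_function_mult polynomial_function_add assms)

lemma polynomial_function_poly2:
  assumes "polynomial_function f" "polynomial_function g"
  shows "polynomial_function (\<lambda>v. poly (poly p [:g v:]) (f v))"
  by (induction p)
    (simp_all add: polynomial_function_const polynomial_function_mult polynomial_function_add
      polynomial_function_poly assms)

lemma polynomial_map_id: "polynomial_map id"
  by (simp add: polynomial_map_def polynomial_function_fst polynomial_function_snd)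

lemma polynomial_function_comp:
  assumes "polynomial_function f" "polynomial_map g"
  shows "polynomial_function (\<lambda>v. f (g v))"
proof -
  obtain p where "\<And>x y. f (x, y) = poly (poly p [:y:]) x"
    using assms(1) unfolding polynomial_function_def by blast
  then have "f (g v) = poly (poly p [:snd (g v):]) (fst (g v))" for v
    by (metis prod.collapse)
  then show ?thesis
    using polynomial_function_poly2[of "\<lambda>v. fst (g v)" "\<lambda>v. snd (g v)" p] assms(2)
    by (simp add: polynomial_map_def)
qed

lemma polynomial_map_comp:
  assumes "polynomial_map f" "polynomial_map g"
  shows "polynomial_map (f \<circ> g)"
  using assms polynomial_function_comp[of "\<lambda>v. fst (f v)" g]
    polynomial_function_comp[of "\<lambda>v. snd (f v)" g]
  by (simp add: polynomial_map_def)

lemma group_Aut_plane: "group (Aut_plane :: ('a::field \<times> 'a \<Rightarrow> 'a \<times> 'a) monoid)"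
proof (rule groupI)
  fix f g :: "'a \<times> 'a \<Rightarrow> 'a \<times> 'a"
  assume "f \<in> carrier Aut_plane" "g \<in> carrier Aut_plane"
  then obtain f' g' where
    f: "polynomial_map f" "polynomial_map f'" "f' \<circ> f = id" "f \<circ> f' = id" and
    g: "polynomial_map g" "polynomial_map g'" "g' \<circ> g = id" "g \<circ> g' = id"
    by (auto simp: Aut_plane_def polynomial_automorphism_def)
  have "(g' \<circ> f') \<circ> (f \<circ> g) = id" "(f \<circ> g) \<circ> (g' \<circ> f') = id"
    using f g by (metis comp_assoc comp_id)+
  then show "f \<otimes>\<^bsub>Aut_plane\<^esub> g \<in> carrier Aut_plane"
    using f g polynomial_map_comp unfolding Aut_plane_def polynomial_automorphism_def by auto
next
  fix f :: "'a \<times> 'a \<Rightarrow> 'a \<times> 'a"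
  assume "f \<in> carrier Aut_plane"
  then show "\<exists>g\<in>carrier Aut_plane. g \<otimes>\<^bsub>Aut_plane\<^esub> f = \<one>\<^bsub>Aut_plane\<^esub>"
    by (auto simp: Aut_plane_def polynomial_automorphism_def)
qed (auto simp: Aut_plane_def polynomial_automorphism_def polynomial_map_id comp_assoc
      intro!: exI[of _ id])

lemma H_subset_Aut_plane: "H a \<subseteq> carrier Aut_plane"
proof
  fix f :: "'a \<times> 'a \<Rightarrow> 'a \<times> 'a"
  assume "f \<in> H a"
  then obtain c where f: "f = (\<lambda>(x, y). (x + c * y ^ a, y))" by (auto simp: H_def)
  define g where "g = (\<lambda>(x::'a, y). (x + (- c) * y ^ a, y))"
  have *: "polynomial_map (\<lambda>(x, y). (x + e * y ^ a, y))" for e :: 'a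
    by (simp add: polynomial_map_def case_prod_beta polynomial_function_const
        polynomial_function_fst polynomial_function_snd polynomial_function_add
        polynomial_function_mult polynomial_function_power)
  have "polynomial_map f" "polynomial_map g"
    unfolding f g_def by (rule *)+
  moreover have "g \<circ> f = id" "f \<circ> g = id"
    by (auto simp: f g_def fun_eq_iff)
  ultimately show "f \<in> carrier Aut_plane"
    by (auto simp: Aut_plane_def polynomial_automorphism_def)
qed

lemma K_subset_Aut_plane: "K b \<subseteq> carrier Aut_plane"
proof
  fix f :: "'a \<times> 'a \<Rightarrow> 'a \<times> 'a"
  assume "f \<in> K b"
  then obtain c where f: "f = (\<lambda>(x, y). (x, y + c * x ^ b))" by (auto simp: K_def)
  define g where "g = (\<lambda>(x::'a, y). (x, y + (- c) * x ^ b))"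
  have *: "polynomial_map (\<lambda>(x, y). (x, y + e * x ^ b))" for e :: 'a
    by (simp add: polynomial_map_def case_prod_beta polynomial_function_const
        polynomial_function_fst polynomial_function_snd polynomial_function_add
        polynomial_function_mult polynomial_function_power)
  have "polynomial_map f" "polynomial_map g"
    unfolding f g_def by (rule *)+
  moreover have "g \<circ> f = id" "f \<circ> g = id"
    by (auto simp: f g_def fun_eq_iff)
  ultimately show "f \<in> carrier Aut_plane"
    by (auto simp: Aut_plane_def polynomial_automorphism_def)
qed


subsection \<open>When the group acts on the punctured plane\<close>

text \<open>
  The maps in \<^term>\<open>K 0\<close> are translations and move the origin, so the restricted maps form an
  action on the punctured plane exactly when no exponent is zero.
\<close>

lemma group_action_punctured_plane_iff:
  fixes d :: "nat \<Rightarrow> nat" and m :: nat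
  defines "S \<equiv> H 1 \<union> (\<Union>i\<in>{1..m}. K (d i)) :: ('a::field \<times> 'a \<Rightarrow> 'a \<times> 'a) set"
  shows "group_action (subgroup_generated Aut_plane S) punctured_plane
           (\<lambda>g. restrict g punctured_plane) \<longleftrightarrow> (\<forall>i\<in>{1..m}. d i \<noteq> 0)"
    (is "?act \<longleftrightarrow> ?pos")
proof
  assume ?act
  then interpret group_action "subgroup_generated Aut_plane S" "punctured_plane :: ('a \<times> 'a) set"
    "\<lambda>g. restrict g punctured_plane" .
  show ?pos
  proof (intro ballI notI)
    fix i assume i: "i \<in> {1..m}" and "d i = 0"
    define g where "g = (\<lambda>(x::'a, y::'a). (x, y + 1 * x ^ d i))"
    have "g \<in> K (d i)" unfolding K_def g_def by blast
    then have "g \<in> S" using i by (auto simp: S_def)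
    moreover have "g \<in> carrier Aut_plane"
      using \<open>g \<in> K (d i)\<close> K_subset_Aut_plane by blast
    ultimately have "g \<in> carrier (subgroup_generated Aut_plane S)"
      by (simp add: carrier_subgroup_generated generate.incl)
    from element_image[OF this, of "(0, - 1)" "(0, 0)"] have "(0, 0) \<in> (punctured_plane :: ('a \<times> 'a) set)"
      using \<open>d i = 0\<close> by (simp add: g_def punctured_plane_def)
    then show False by (simp add: punctured_plane_def)
  qed
next
  assume pos: ?pos
  interpret A: group "Aut_plane :: ('a \<times> 'a \<Rightarrow> 'a \<times> 'a) monoid" by (rule group_Aut_plane)
  have S: "S \<subseteq> carrier Aut_plane"
    using H_subset_Aut_plane K_subset_Aut_plane by (auto simp: S_def)
  have bij: "bij g" if "g \<in> carrier Aut_plane" for g :: "'a \<times> 'a \<Rightarrow> 'a \<times> 'a"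
    using that by (auto simp: Aut_plane_def polynomial_automorphism_def intro: o_bij)
  have S0: "h (0, 0) = (0, 0)" if "h \<in> S" for h
    using that pos by (auto simp: S_def H_def K_def)
  have sub: "g \<in> carrier Aut_plane" if "g \<in> generate Aut_plane S" for g
    using that A.generate_in_carrier[OF S] by blast
  have fix0: "g (0, 0) = (0, 0)" if "g \<in> generate Aut_plane S" for g
    using that
  proof induction
    case (inv h)
    have "inv\<^bsub>Aut_plane\<^esub> h \<circ> h = id"
      using A.l_inv[of h] inv S by (auto simp: Aut_plane_def)
    then have "(inv\<^bsub>Aut_plane\<^esub> h) (h (0, 0)) = (0, 0)" by (metis comp_apply id_apply)
    then show ?case using S0[OF inv] by simp
  qed (auto simp: Aut_plane_def S0)
  have carr: "carrier (subgroup_generated Aut_plane S) = generate Aut_plane S"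
    using S by (simp add: carrier_subgroup_generated Int_absorb1)
  have mult: "f \<otimes>\<^bsub>Aut_plane\<^esub> g = f \<circ> g" for f g :: "'a \<times> 'a \<Rightarrow> 'a \<times> 'a"
    by (simp add: Aut_plane_def)
  have Bij: "restrict g punctured_plane \<in> Bij punctured_plane" if "g \<in> generate Aut_plane S" for g
  proof -
    have "bij g" using bij sub that by blast
    then have "bij_betw g (UNIV - {(0, 0)}) (g ` (UNIV - {(0, 0)}))"
      by (metis bij_is_inj inj_on_imp_bij_betw inj_on_subset subset_UNIV)
    moreover have "g ` (UNIV - {(0, 0)}) = UNIV - {(0, 0)}"
      using \<open>bij g\<close> fix0[OF that] by (simp add: image_set_diff bij_is_inj bij_is_surj)
    ultimately show ?thesis
      by (simp add: Bij_def punctured_plane_def)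
  qed
  show ?act
    unfolding group_action_def group_hom_def group_hom_axioms_def
  proof (intro conjI homI)
    fix f g assume fg: "f \<in> carrier (subgroup_generated Aut_plane S)"
      "g \<in> carrier (subgroup_generated Aut_plane S)"
    have "g v \<in> punctured_plane" if "v \<in> punctured_plane" for v
      using Bij[of g] fg that by (auto simp: carr Bij_def bij_betw_def)
    then show "restrict (f \<otimes>\<^bsub>subgroup_generated Aut_plane S\<^esub> g) punctured_plane =
        restrict f punctured_plane \<otimes>\<^bsub>BijGroup punctured_plane\<^esub> restrict g punctured_plane"
      using Bij[of f] Bij[of g] fg unfolding carr
      by (auto simp: BijGroup_def compose_def mult fun_eq_iff)
  qed (use group_BijGroup Bij in \<open>simp_all add: A.group_subgroup_generated carr, simp_all add: BijGroup_def\<close>)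
qed

end

theory Submission
  imports Defs
begin

text \<open>
  If the gcd is not \<open>1\<close>, there is a scalar \<open>\<epsilon> \<noteq> 0, 1\<close> with \<open>\<epsilon> ^ d i = \<epsilon>\<close> for all \<open>i\<close> (a root of
  unity, or any scalar if all \<open>d i\<close> are \<open>1\<close>); the group commutes with scaling by \<open>\<epsilon>\<close>, so it is not
  2-transitive.

  Conversely, consider the vector fields that are velocities of polynomial curves in the group
  starting at the identity. They form a linear space stable under conjugation, which contains
  \<open>(0, x ^ d i)\<close> and, with \<open>(0, x ^ N)\<close>, also \<open>(0, x ^ (N + d i - 1))\<close>; when the gcd is \<open>1\<close> it therefore
  contains \<open>(0, x ^ N)\<close> for all large \<open>N\<close>. By interpolation these fields and their conjugates take
  arbitrary values at finitely many distinct points \<open>p 1, \<dots>, p n\<close> of the punctured plane. Hence some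
  product of the one-parameter subgroups moves \<open>(p 1, \<dots>, p n)\<close> over a set that lies in no proper
  hypersurface of the space of \<open>n\<close>-tuples. This set is constructible by Chevalley's theorem, so
  it contains the complement of a hypersurface. Two such sets meet, so any two orbits of tuples
  of distinct points meet.
\<close>

section \<open>Constructible sets\<close>

text \<open>Over an algebraically closed field \<open>p\<close> splits into linear factors, and no
  root has multiplicity above \<open>degree p\<close>. A statement about all roots thus becomes a
  divisibility, which pseudo-division can test.\<close>

lemma roots_subset_iff_dvd_power:
  fixes p f :: "'a::alg_closed_field poly"
  assumes "p \<noteq> 0"
  shows "(\<forall>t. poly p t = 0 \<longrightarrow> poly f t = 0) \<longleftrightarrow> p dvd f ^ degree p"
proof
  show "p dvd f ^ degree p" if "\<forall>t. poly p t = 0 \<longrightarrow> poly f t = 0"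
    using that assms
  proof (induction "degree p" arbitrary: p)
    case 0
    then obtain c where "p = [:c:]" "c \<noteq> 0" by (metis degree_eq_zeroE pCons_0_0)
    then show ?case by (auto simp: const_poly_dvd_iff dvd_field_iff)
  next
    case (Suc n)
    then obtain a where a: "poly p a = 0"
      using alg_closed_imp_poly_has_root[of p] by auto
    then obtain q where q: "p = [:- a, 1:] * q"
      by (auto simp: poly_eq_0_iff_dvd)
    with Suc have "q \<noteq> 0" by auto
    then have deg: "degree p = Suc (degree q)"
      by (simp add: q degree_mult_eq del: mult_pCons_left)
    have "q dvd f ^ degree q"
      using Suc.hyps(1)[of q] Suc.hyps(2) Suc.prems deg \<open>q \<noteq> 0\<close> by (auto simp: q)
    moreover have "[:- a, 1:] dvd f"
      using Suc.prems a by (simp add: poly_eq_0_iff_dvd)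
    ultimately show ?case unfolding deg by (simp only: power_Suc q mult_dvd_mono)
  qed
next
  assume "p dvd f ^ degree p"
  then obtain r where "f ^ degree p = p * r" by (rule dvdE)
  then have "poly f t ^ degree p = poly p t * poly r t" for t
    by (metis poly_mult poly_power)
  then show "\<forall>t. poly p t = 0 \<longrightarrow> poly f t = 0"
    by (metis mult_zero_left power_not_zero)
qed

section \<open>Families of univariate polynomials over a ring of functions\<close>

locale function_ring =
  fixes R :: "('x \<Rightarrow> 'a::{alg_closed_field,field_char_0}) set"
  assumes const: "(\<lambda>_. c) \<in> R"
    and add: "f \<in> R \<Longrightarrow> g \<in> R \<Longrightarrow> (\<lambda>x. f x + g x) \<in> R"
    and mult: "f \<in> R \<Longrightarrow> g \<in> R \<Longrightarrow> (\<lambda>x. f x * g x) \<in> R"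
begin

lemma diff: "f \<in> R \<Longrightarrow> g \<in> R \<Longrightarrow> (\<lambda>x. f x - g x) \<in> R"
  using add[OF _ mult[OF const[of "- 1"]], of f g] by simp

lemma sum: "(\<And>i. i \<in> A \<Longrightarrow> f i \<in> R) \<Longrightarrow> (\<lambda>x. \<Sum>i\<in>A. f i x) \<in> R"
  by (induction A rule: infinite_finite_induct) (auto intro: const add)

text \<open>The bound \<open>n\<close> on the degrees is strict and uniform in \<open>x\<close>. The
  coefficient just below it may vanish at some \<open>x\<close>, which is why the eliminations below
  split into cases.\<close>

definition poly_family :: "nat \<Rightarrow> ('x \<Rightarrow> 'a poly) \<Rightarrow> bool" where
  "poly_family n P \<longleftrightarrow> (\<forall>j. (\<lambda>x. coeff (P x) j) \<in> R) \<and> (\<forall>x. \<forall>j\<ge>n. coeff (P x) j = 0)"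

lemma poly_family_coeff: "poly_family n P \<Longrightarrow> (\<lambda>x. coeff (P x) j) \<in> R"
  by (simp add: poly_family_def)

lemma poly_family_coeff_eq_0: "poly_family n P \<Longrightarrow> n \<le> j \<Longrightarrow> coeff (P x) j = 0"
  by (simp add: poly_family_def)

lemma poly_family_mono: "poly_family n P \<Longrightarrow> n \<le> m \<Longrightarrow> poly_family m P"
  by (auto simp: poly_family_def)

lemma poly_family_0: "poly_family 0 P \<longleftrightarrow> P = (\<lambda>_. 0)"
  by (auto simp: poly_family_def fun_eq_iff poly_eq_iff const)

lemma poly_family_const:
  assumes "f \<in> R"
  shows "poly_family 1 (\<lambda>x. [:f x:])"
proof -
  have "(\<lambda>x. coeff [:f x:] j) \<in> R" for j using assms by (cases j) (auto simp: const)
  then show ?thesis by (auto simp: poly_family_def coeff_pCons split: nat.split)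
qed

lemma poly_family_add: "poly_family n P \<Longrightarrow> poly_family n Q \<Longrightarrow> poly_family n (\<lambda>x. P x + Q x)"
  by (auto simp: poly_family_def add)

lemma poly_family_mult:
  assumes "poly_family n P" "poly_family m Q"
  shows "poly_family (n + m) (\<lambda>x. P x * Q x)"
proof -
  have "coeff (P x) i * coeff (Q x) (j - i) = 0" if "n + m \<le> j" for x i j
    using assms that by (cases "n \<le> i") (auto simp: poly_family_def)
  then have "coeff (P x * Q x) j = 0" if "n + m \<le> j" for x j
    unfolding coeff_mult using that by (intro sum.neutral ballI)
  moreover have "(\<lambda>x. coeff (P x * Q x) j) \<in> R" for j
    unfolding coeff_mult by (intro sum mult poly_family_coeff[OF assms(1)] poly_family_coeff[OF assms(2)])
  ultimately show ?thesis by (simp add: poly_family_def)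
qed

lemma poly_family_power: "poly_family n P \<Longrightarrow> \<exists>k. poly_family k (\<lambda>x. P x ^ j)"
proof (induction j)
  case 0
  then show ?case using poly_family_const[OF const[of 1]] by (auto simp: one_pCons)
next
  case (Suc j)
  then show ?case using poly_family_mult by fastforce
qed

lemma poly_family_drop_lead:
  assumes "poly_family (Suc n) P"
  shows "poly_family n (\<lambda>x. P x - monom (coeff (P x) n) n)"
proof -
  have "(\<lambda>x. coeff (P x - monom (coeff (P x) n) n) j) \<in> R" for j
    by (cases "n = j") (simp_all add: const poly_family_coeff[OF assms])
  moreover have "coeff (P x - monom (coeff (P x) n) n) j = 0" if "n \<le> j" for x j
  proof (cases "n = j")
    case False
    then have "coeff (P x) j = 0" using that by (intro poly_family_coeff_eq_0[OF assms]) simp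
    with False show ?thesis by simp
  qed simp
  ultimately show ?thesis unfolding poly_family_def by blast
qed

text \<open>Cross-multiplying by the two top coefficients cancels the term of degree
  \<open>m\<close> without any division, so all coefficients stay in \<open>R\<close>.\<close>

lemma poly_family_pseudo_reduce:
  assumes P: "poly_family (Suc n) P" and Q: "poly_family (Suc m) Q" and "n \<le> m"
  defines "S \<equiv> (\<lambda>x. smult (coeff (P x) n) (Q x) - smult (coeff (Q x) m) (monom 1 (m - n) * P x))"
  shows "poly_family m S"
proof -
  have "poly_family (Suc (m - n)) (\<lambda>x. monom 1 (m - n))"
    by (auto simp: poly_family_def const)
  from poly_family_mult[OF this P] have "(\<lambda>x. coeff (monom 1 (m - n) * P x) j) \<in> R" for j
    by (rule poly_family_coeff)
  then have "(\<lambda>x. coeff (S x) j) \<in> R" for j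
    unfolding S_def coeff_diff coeff_smult
    by (intro diff mult poly_family_coeff[OF P] poly_family_coeff[OF Q])
  moreover have "coeff (S x) j = 0" if "m \<le> j" for x j
  proof (cases "m = j")
    case True
    then show ?thesis using \<open>n \<le> m\<close> by (simp add: S_def coeff_monom_mult)
  next
    case False
    then have "Suc m \<le> j" "Suc n \<le> j - (m - n)" using that \<open>n \<le> m\<close> by auto
    then show ?thesis using P Q by (simp add: S_def coeff_monom_mult poly_family_def)
  qed
  ultimately show ?thesis by (simp add: poly_family_def)
qed

text \<open>Where \<open>coeff (P x) n\<close> is nonzero it is a unit, so the reductions do not
  change divisibility by \<open>P x\<close>. A remainder of degree below \<open>n\<close> is then
  divisible by \<open>P x\<close> only if it is zero.\<close>

lemma poly_family_pseudo_mod: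
  assumes P: "poly_family (Suc n) P"
  shows "poly_family m Q \<Longrightarrow> \<exists>S. poly_family n S \<and>
           (\<forall>x. coeff (P x) n \<noteq> 0 \<longrightarrow> (P x dvd Q x \<longleftrightarrow> P x dvd S x))"
proof (induction m arbitrary: Q)
  case 0
  then show ?case by (intro exI[of _ Q]) (auto intro: poly_family_mono)
next
  case (Suc m)
  show ?case
  proof (cases "Suc m \<le> n")
    case True
    then show ?thesis using Suc.prems by (intro exI[of _ Q]) (auto intro: poly_family_mono)
  next
    case False
    define Q' where
      "Q' = (\<lambda>x. smult (coeff (P x) n) (Q x) - smult (coeff (Q x) m) (monom 1 (m - n) * P x))"
    have "poly_family m Q'"
      using poly_family_pseudo_reduce[OF P Suc.prems] False by (simp add: Q'_def)
    moreover have "P x dvd Q x \<longleftrightarrow> P x dvd Q' x" if "coeff (P x) n \<noteq> 0" for x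
    proof -
      have "P x dvd smult (coeff (Q x) m) (monom 1 (m - n) * P x)" by (simp add: dvd_smult)
      then have "P x dvd Q' x \<longleftrightarrow> P x dvd smult (coeff (P x) n) (Q x)"
        unfolding Q'_def by (rule dvd_diff_left_iff)
      then show ?thesis using that by (simp add: dvd_smult_iff)
    qed
    ultimately show ?thesis using Suc.IH[of Q'] by auto
  qed
qed

section \<open>Constructible sets and their projections\<close>

inductive_set constructible :: "'x set set" where
  zeros: "f \<in> R \<Longrightarrow> {x. f x = 0} \<in> constructible"
| nonzeros: "f \<in> R \<Longrightarrow> {x. f x \<noteq> 0} \<in> constructible"
| Un: "A \<in> constructible \<Longrightarrow> B \<in> constructible \<Longrightarrow> A \<union> B \<in> constructible"
| Int: "A \<in> constructible \<Longrightarrow> B \<in> constructible \<Longrightarrow> A \<inter> B \<in> constructible"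

lemma constructible_empty: "{} \<in> constructible"
  using zeros[OF const[of 1]] by simp

lemma constructible_UNIV: "UNIV \<in> constructible"
  using zeros[OF const[of 0]] by simp

lemma constructible_exists_coeff:
  assumes "poly_family n P"
  shows "{x. P x \<noteq> 0} \<in> constructible"
proof -
  have "(\<Union>j\<in>A. {x. coeff (P x) j \<noteq> 0}) \<in> constructible" if "finite A" for A
    using that
    by induction (auto intro!: constructible_empty Un nonzeros poly_family_coeff[OF assms])
  moreover have "{x. P x \<noteq> 0} = (\<Union>j\<in>{..<n}. {x. coeff (P x) j \<noteq> 0})"
    using poly_family_coeff_eq_0[OF assms] by (auto simp: poly_eq_iff) (meson lessThan_iff not_le)
  ultimately show ?thesis by simp
qed

text \<open>One equation and one inequation per piece is the form in which the fibre variable can be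
  eliminated. Intersections create a second equation, which Euclid's algorithm removes.\<close>

inductive_set constructible_over :: "('x \<times> 'a) set set" where
  basic: "C \<in> constructible \<Longrightarrow> poly_family n P \<Longrightarrow> poly_family m Q \<Longrightarrow>
    {(x, t). x \<in> C \<and> poly (P x) t = 0 \<and> poly (Q x) t \<noteq> 0} \<in> constructible_over"
| Un_over: "A \<in> constructible_over \<Longrightarrow> B \<in> constructible_over \<Longrightarrow> A \<union> B \<in> constructible_over"

text \<open>Euclid's algorithm over the base, splitting on whether a leading coefficient vanishes.\<close>

lemma constructible_over_common_zeros:
  assumes "C \<in> constructible" "poly_family n P" "poly_family m Q" "poly_family l F"
  shows "{(x, t). x \<in> C \<and> poly (P x) t = 0 \<and> poly (Q x) t = 0 \<and> poly (F x) t \<noteq> 0}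
           \<in> constructible_over" (is "?S C P Q \<in> _")
  using assms(1-3)
proof (induction "n + m" arbitrary: n m P Q C rule: less_induct)
  case less
  \<comment> \<open>Common zeros are symmetric in \<open>P\<close> and \<open>Q\<close>, so the
    family with the smaller degree bound can play the divisor.\<close>
  have *: "?S C P Q \<in> constructible_over"
    if "C \<in> constructible" "poly_family i P" "poly_family j Q" "i + j = n + m" "i \<le> j" for i j P Q C
  proof (cases i)
    case 0
    then show ?thesis using basic[OF that(1) that(3) assms(4)] that by (simp add: poly_family_0)
  next
    case (Suc i')
    then obtain j' where j: "j = Suc j'" using \<open>i \<le> j\<close> by (cases j) auto
    define P' where "P' = (\<lambda>x. P x - monom (coeff (P x) i') i')"
    define Q' where
      "Q' = (\<lambda>x. smult (coeff (P x) i') (Q x) - smult (coeff (Q x) j') (monom 1 (j' - i') * P x))"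
    let ?C0 = "C \<inter> {x. coeff (P x) i' = 0}" and ?C1 = "C \<inter> {x. coeff (P x) i' \<noteq> 0}"
    have fP: "poly_family (Suc i') P" and fQ: "poly_family (Suc j') Q"
      using that Suc j by auto
    have "?S ?C0 P' Q \<in> constructible_over"
      by (rule less(1)[of i' j])
        (use that Suc fP in \<open>auto simp: P'_def intro!: poly_family_drop_lead Int zeros poly_family_coeff\<close>)
    moreover have "?S ?C1 P Q' \<in> constructible_over"
      by (rule less(1)[of i j'])
        (use that j Suc fP fQ in \<open>auto simp: Q'_def
          intro!: poly_family_pseudo_reduce Int nonzeros poly_family_coeff\<close>)
    moreover have "?S C P Q = ?S ?C0 P' Q \<union> ?S ?C1 P Q'"
    proof (rule Set.set_eqI)
      fix z
      show "z \<in> ?S C P Q \<longleftrightarrow> z \<in> ?S ?C0 P' Q \<union> ?S ?C1 P Q'"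
        by (cases z; cases "coeff (P (fst z)) i' = 0") (simp_all add: P'_def Q'_def cong: conj_cong)
    qed
    ultimately show ?thesis by (simp only: Un_over)
  qed
  show ?case
  proof (cases "n \<le> m")
    case True
    then show ?thesis using *[of C n P m Q] less.prems by simp
  next
    case False
    then have "?S C Q P \<in> constructible_over" using *[of C m Q n P] less.prems by simp
    moreover have "?S C Q P = ?S C P Q" by auto
    ultimately show ?thesis by simp
  qed
qed

lemma constructible_over_Int:
  assumes "A \<in> constructible_over" "B \<in> constructible_over"
  shows "A \<inter> B \<in> constructible_over"
  using assms
proof (induction A)
  case (Un_over A A')
  then show ?case by (simp add: Int_Un_distrib2 constructible_over.Un_over)
next
  case (basic C n P m Q)
  note outer = basic(1-3)
  show ?case using basic(4)
  proof (induction B)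
    case (Un_over B B')
    then show ?case by (simp add: Int_Un_distrib constructible_over.Un_over)
  next
    case (basic C' n' P' m' Q')
    have "{(x, t). x \<in> C \<inter> C' \<and> poly (P x) t = 0 \<and> poly (P' x) t = 0 \<and> poly (Q x * Q' x) t \<noteq> 0}
      \<in> constructible_over"
      by (rule constructible_over_common_zeros[OF Int[OF outer(1) basic(1)] outer(2) basic(2)
            poly_family_mult[OF outer(3) basic(3)]])
    also have "{(x, t). x \<in> C \<inter> C' \<and> poly (P x) t = 0 \<and> poly (P' x) t = 0 \<and> poly (Q x * Q' x) t \<noteq> 0} =
      {(x, t). x \<in> C \<and> poly (P x) t = 0 \<and> poly (Q x) t \<noteq> 0} \<inter>
      {(x, t). x \<in> C' \<and> poly (P' x) t = 0 \<and> poly (Q' x) t \<noteq> 0}" by auto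
    finally show ?case .
  qed
qed

text \<open>Quantifier elimination in one variable. Where the top coefficient of \<open>P x\<close>
  is nonzero, some zero of \<open>P x\<close> avoids the zeros of \<open>Q x\<close> iff
  \<open>P x\<close> does not divide \<open>Q x ^ n\<close>, that is, iff a pseudo-remainder
  \<open>S x\<close> is nonzero. Elsewhere the degree bound drops.\<close>

lemma constructible_fibre_nonempty:
  assumes "C \<in> constructible" "poly_family n P" "poly_family m Q"
  shows "{x \<in> C. \<exists>t. poly (P x) t = 0 \<and> poly (Q x) t \<noteq> 0} \<in> constructible"
  using assms
proof (induction n arbitrary: C P)
  case 0
  \<comment> \<open>The zero polynomial imposes no equation, and a nonzero \<open>Q x\<close> has a
    non-root because the field is infinite.\<close>
  have "{x \<in> C. \<exists>t. poly (P x) t = 0 \<and> poly (Q x) t \<noteq> 0} = C \<inter> {x. Q x \<noteq> 0}"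
    using 0 poly_all_0_iff_0 by (auto simp: poly_family_0)
  then show ?case using 0 by (simp add: Int constructible_exists_coeff)
next
  case (Suc n)
  define P' where "P' = (\<lambda>x. P x - monom (coeff (P x) n) n)"
  have P': "P' x = P x" if "coeff (P x) n = 0" for x using that by (simp add: P'_def)
  let ?C0 = "C \<inter> {x. coeff (P x) n = 0}" and ?C1 = "C \<inter> {x. coeff (P x) n \<noteq> 0}"
  have C: "?C0 \<in> constructible" "?C1 \<in> constructible"
    using Suc.prems by (auto intro!: Int zeros nonzeros poly_family_coeff)
  obtain k where "poly_family k (\<lambda>x. Q x ^ n)"
    using poly_family_power[OF Suc.prems(3)] by blast
  then obtain S where S: "poly_family n S"
    and dvd: "\<And>x. coeff (P x) n \<noteq> 0 \<Longrightarrow> P x dvd Q x ^ n \<longleftrightarrow> P x dvd S x"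
    using poly_family_pseudo_mod[OF Suc.prems(2)] by blast
  have "{x \<in> ?C0. \<exists>t. poly (P' x) t = 0 \<and> poly (Q x) t \<noteq> 0} \<in> constructible"
    by (rule Suc.IH) (use C Suc.prems in \<open>auto simp: P'_def intro: poly_family_drop_lead\<close>)
  moreover have "?C1 \<inter> {x. S x \<noteq> 0} \<in> constructible"
    by (intro constructible.Int C constructible_exists_coeff) fact
  moreover have "(\<exists>t. poly (P x) t = 0 \<and> poly (Q x) t \<noteq> 0) \<longleftrightarrow> S x \<noteq> 0"
    if "coeff (P x) n \<noteq> 0" for x
  proof -
    have "\<forall>j\<ge>Suc n. coeff (P x) j = 0"
      using Suc.prems(2) by (simp add: poly_family_def)
    then have deg: "degree (P x) = n"
      using that by (intro antisym le_degree degree_le) auto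
    have "degree (S x) < n" if "S x \<noteq> 0"
      using S that by (metis leading_coeff_0_iff not_le poly_family_def)
    then have "P x dvd S x \<longleftrightarrow> S x = 0"
      using dvd_imp_degree_le[of "P x" "S x"] deg by fastforce
    moreover have "P x \<noteq> 0" using that by auto
    ultimately show ?thesis
      using roots_subset_iff_dvd_power[of "P x" "Q x"] dvd[OF that] deg by auto
  qed
  then have iff: "x \<in> {x \<in> C. \<exists>t. poly (P x) t = 0 \<and> poly (Q x) t \<noteq> 0} \<longleftrightarrow>
    x \<in> {x \<in> ?C0. \<exists>t. poly (P' x) t = 0 \<and> poly (Q x) t \<noteq> 0} \<union> (?C1 \<inter> {x. S x \<noteq> 0})"
    for x using P'[of x] by (cases "coeff (P x) n = 0") auto
  ultimately show ?case unfolding Set.set_eqI[OF iff] by (intro Un)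
qed

lemma constructible_projection: "A \<in> constructible_over \<Longrightarrow> {x. \<exists>t. (x, t) \<in> A} \<in> constructible"
proof (induction rule: constructible_over.induct)
  case (basic C n P m Q)
  then show ?case using constructible_fibre_nonempty[OF basic] by simp
next
  case (Un_over A B)
  have "{x. \<exists>t. (x, t) \<in> A \<union> B} = {x. \<exists>t. (x, t) \<in> A} \<union> {x. \<exists>t. (x, t) \<in> B}" by auto
  then show ?case using Un_over by (simp add: Un)
qed

text \<open>An equation is completed by the inequation \<open>1 \<noteq> 0\<close> and an inequation
  by the equation \<open>0 = 0\<close>; unions and intersections are inherited.\<close>

lemma constructible_over_vimage:
  assumes "S \<in> constructible"
    and "\<And>f. f \<in> R \<Longrightarrow> \<exists>n P. poly_family n P \<and> (\<forall>x t. f (s t x) = poly (P x) t)"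
  shows "{(x, t). s t x \<in> S} \<in> constructible_over"
  using assms(1)
proof induction
  case (zeros f)
  then obtain n P where "poly_family n P" "\<And>x t. f (s t x) = poly (P x) t" using assms(2) by blast
  with basic[OF constructible_UNIV this(1) poly_family_const[OF const[of 1]]] show ?case by simp
next
  case (nonzeros f)
  then obtain n P where "poly_family n P" "\<And>x t. f (s t x) = poly (P x) t" using assms(2) by blast
  with basic[OF constructible_UNIV poly_family_const[OF const[of 0]] this(1)] show ?case by simp
next
  case (Un A B)
  have "{(x, t). s t x \<in> A \<union> B} = {(x, t). s t x \<in> A} \<union> {(x, t). s t x \<in> B}" by auto
  then show ?case using Un by (simp add: Un_over)
next
  case (Int A B)
  have "{(x, t). s t x \<in> A \<inter> B} = {(x, t). s t x \<in> A} \<inter> {(x, t). s t x \<in> B}" by auto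
  then show ?case using Int by (simp add: constructible_over_Int)
qed

text \<open>The hypothesis \<open>dom\<close> expresses irreducibility of the space. For unions and
  intersections the product of the two functions serves in every case; for a function that vanishes
  identically the constant 1 is the witness.\<close>

lemma constructible_thin_or_thick:
  assumes dom: "\<And>f g. f \<in> R \<Longrightarrow> g \<in> R \<Longrightarrow> (\<exists>x. f x \<noteq> 0) \<Longrightarrow> (\<exists>x. g x \<noteq> 0) \<Longrightarrow> \<exists>x. f x * g x \<noteq> 0"
    and "S \<in> constructible"
  shows "\<exists>f\<in>R. (\<exists>x. f x \<noteq> 0) \<and> ((\<forall>x\<in>S. f x = 0) \<or> (\<forall>x. f x \<noteq> 0 \<longrightarrow> x \<in> S))"
  using assms(2)
proof induction
  case (zeros f)
  then show ?case
    by (cases "\<exists>x. f x \<noteq> 0") (blast, rule bexI[OF _ const[of 1]], simp)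
next
  case (nonzeros f)
  then show ?case
    by (cases "\<exists>x. f x \<noteq> 0") (blast, rule bexI[OF _ const[of 1]], simp)
next
  case (Un A B)
  then obtain f g where fg: "f \<in> R" "g \<in> R" "\<exists>x. f x \<noteq> 0" "\<exists>x. g x \<noteq> 0" and
    ab: "(\<forall>x\<in>A. f x = 0) \<or> (\<forall>x. f x \<noteq> 0 \<longrightarrow> x \<in> A)" "(\<forall>x\<in>B. g x = 0) \<or> (\<forall>x. g x \<noteq> 0 \<longrightarrow> x \<in> B)"
    by blast
  from ab have "(\<forall>x\<in>A \<union> B. f x * g x = 0) \<or> (\<forall>x. f x * g x \<noteq> 0 \<longrightarrow> x \<in> A \<union> B)"
    by (elim disjE) fastforce+
  with dom[OF fg] show ?case by (rule bexI[OF conjI mult[OF fg(1,2)]])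
next
  case (Int A B)
  then obtain f g where fg: "f \<in> R" "g \<in> R" "\<exists>x. f x \<noteq> 0" "\<exists>x. g x \<noteq> 0" and
    ab: "(\<forall>x\<in>A. f x = 0) \<or> (\<forall>x. f x \<noteq> 0 \<longrightarrow> x \<in> A)" "(\<forall>x\<in>B. g x = 0) \<or> (\<forall>x. g x \<noteq> 0 \<longrightarrow> x \<in> B)"
    by blast
  from ab have "(\<forall>x\<in>A \<inter> B. f x * g x = 0) \<or> (\<forall>x. f x * g x \<noteq> 0 \<longrightarrow> x \<in> A \<inter> B)"
    by (elim disjE) fastforce+
  with dom[OF fg] show ?case by (rule bexI[OF conjI mult[OF fg(1,2)]])
qed

end

section \<open>Polynomial functions of tuples of points\<close>

text \<open>The coordinate ring of the space of tuples indexed by \<open>I\<close>. Tuples are total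
  functions, of which only the entries in \<open>I\<close> are seen
  (\<open>point_polys_cong\<close>).\<close>

inductive_set point_polys :: "'i set \<Rightarrow> (('i \<Rightarrow> 'a::field \<times> 'a) \<Rightarrow> 'a) set" for I where
  const: "(\<lambda>_. c) \<in> point_polys I"
| fst: "i \<in> I \<Longrightarrow> (\<lambda>x. fst (x i)) \<in> point_polys I"
| snd: "i \<in> I \<Longrightarrow> (\<lambda>x. snd (x i)) \<in> point_polys I"
| add: "f \<in> point_polys I \<Longrightarrow> g \<in> point_polys I \<Longrightarrow> (\<lambda>x. f x + g x) \<in> point_polys I"
| mult: "f \<in> point_polys I \<Longrightarrow> g \<in> point_polys I \<Longrightarrow> (\<lambda>x. f x * g x) \<in> point_polys I"

interpretation pp: function_ring "point_polys I"
  by unfold_locales (auto intro: point_polys.intros)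

lemma point_polys_cong: "f \<in> point_polys I \<Longrightarrow> (\<And>i. i \<in> I \<Longrightarrow> x i = y i) \<Longrightarrow> f x = f y"
  by (induction rule: point_polys.induct) auto

lemma point_polys_along_curve:
  assumes "f \<in> point_polys I"
  shows "\<exists>q. \<forall>s. f (\<lambda>i. (poly (X i) s, poly (Y i) s)) = poly q s"
  using assms
proof induction
  case (const c)
  then show ?case by (intro exI[of _ "[:c:]"]) simp
next
  case (add f g)
  then show ?case by (metis poly_add)
next
  case (mult f g)
  then show ?case by (metis poly_mult)
qed auto

text \<open>Along the affine path from a point where \<open>f\<close> is nonzero to one where
  \<open>g\<close> is nonzero, both become nonzero univariate polynomials, whose product is nonzero
  at some parameter.\<close>

lemma point_polys_no_zero_divisors:
  fixes f g :: "('i \<Rightarrow> 'a::field_char_0 \<times> 'a) \<Rightarrow> 'a"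
  assumes f: "f \<in> point_polys I" and g: "g \<in> point_polys I"
    and "\<exists>x. f x \<noteq> 0" "\<exists>x. g x \<noteq> 0"
  shows "\<exists>x. f x * g x \<noteq> 0"
proof -
  obtain x y where xy: "f x \<noteq> 0" "g y \<noteq> 0" using assms by blast
  define X where "X = (\<lambda>i. [:fst (x i), fst (y i) - fst (x i):])"
  define Y where "Y = (\<lambda>i. [:snd (x i), snd (y i) - snd (x i):])"
  let ?z = "\<lambda>s i. (poly (X i) s, poly (Y i) s)"
  obtain p where p: "\<And>s. f (?z s) = poly p s" using point_polys_along_curve[OF f] by blast
  obtain q where q: "\<And>s. g (?z s) = poly q s" using point_polys_along_curve[OF g] by blast
  have "?z 0 = x" "?z 1 = y" by (auto simp: X_def Y_def)
  then have "poly p 0 \<noteq> 0" "poly q 1 \<noteq> 0" using xy p q by metis+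
  then have "p * q \<noteq> 0" by auto
  then obtain s where "poly (p * q) s \<noteq> 0" using poly_all_0_iff_0 by blast
  then show ?thesis by (metis p q poly_mult)
qed

text \<open>Ring operations preserve polynomial dependence on \<open>t\<close>, so checking the
  coordinates suffices. This supplies the hypothesis of
  \<open>constructible_over_vimage\<close>.\<close>

lemma point_polys_substitution:
  fixes \<sigma> :: "'a::{alg_closed_field,field_char_0} \<Rightarrow> ('i \<Rightarrow> 'a \<times> 'a) \<Rightarrow> 'i \<Rightarrow> 'a \<times> 'a"
  assumes "\<And>i. i \<in> I \<Longrightarrow> \<exists>n P. pp.poly_family I n P \<and> (\<forall>x t. fst (\<sigma> t x i) = poly (P x) t)"
    and "\<And>i. i \<in> I \<Longrightarrow> \<exists>n P. pp.poly_family I n P \<and> (\<forall>x t. snd (\<sigma> t x i) = poly (P x) t)"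
    and "f \<in> point_polys I"
  shows "\<exists>n P. pp.poly_family I n P \<and> (\<forall>x t. f (\<sigma> t x) = poly (P x) t)"
  using assms(3)
proof induction
  case (const c)
  show ?case
    using pp.poly_family_const[OF point_polys.const[where c = c]] by fastforce
next
  case (add f g)
  then obtain n P m Q where *: "pp.poly_family I n P" "\<And>x t. f (\<sigma> t x) = poly (P x) t"
    "pp.poly_family I m Q" "\<And>x t. g (\<sigma> t x) = poly (Q x) t" by blast
  have "pp.poly_family I (max n m) (\<lambda>x. P x + Q x)"
    by (intro pp.poly_family_add pp.poly_family_mono[OF *(1)]
        pp.poly_family_mono[OF *(3)]) auto
  with * show ?case by (metis poly_add)
next
  case (mult f g)
  then obtain n P m Q where *: "pp.poly_family I n P" "\<And>x t. f (\<sigma> t x) = poly (P x) t"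
    "pp.poly_family I m Q" "\<And>x t. g (\<sigma> t x) = poly (Q x) t" by blast
  from pp.poly_family_mult[OF *(1,3)] * show ?case by (metis poly_mult)
qed (use assms in auto)

lemma poly_family_linear:
  fixes f g :: "('i \<Rightarrow> 'a::{alg_closed_field,field_char_0} \<times> 'a) \<Rightarrow> 'a"
  assumes "f \<in> point_polys I" "g \<in> point_polys I"
  shows "pp.poly_family I 2 (\<lambda>x. [:f x, g x:])"
proof -
  have "(\<lambda>x. coeff [:f x, g x:] j) \<in> point_polys I" for j
    using assms by (cases j; cases "j - 1") (auto simp: coeff_pCons intro: point_polys.const)
  then show ?thesis
    by (auto simp: pp.poly_family_def coeff_pCons split: nat.split)
qed

text \<open>
  Along a curve \<open>p + s v + \<dots>\<close> the function \<open>f\<close> starts with \<open>s\<^sup>k\<close> times the value at \<open>v\<close> of the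
  lowest nonzero homogeneous part of \<open>f\<close> at \<open>p\<close>.
\<close>

lemma point_polys_nonzero_on_curves:
  fixes f :: "('i \<Rightarrow> 'a::{alg_closed_field,field_char_0} \<times> 'a) \<Rightarrow> 'a"
  assumes f: "f \<in> point_polys I" "\<exists>x. f x \<noteq> 0"
    and curves: "\<And>v. \<exists>X Y. (\<forall>i\<in>I. poly (X i) 0 = fst (p i) \<and> poly (Y i) 0 = snd (p i) \<and>
        poly (pderiv (X i)) 0 = fst (v i) \<and> poly (pderiv (Y i)) 0 = snd (v i)) \<and>
      (\<forall>s. (\<lambda>i. (poly (X i) s, poly (Y i) s)) \<in> S)"
  shows "\<exists>x\<in>S. f x \<noteq> 0"
proof (rule ccontr)
  assume *: "\<not> (\<exists>x\<in>S. f x \<noteq> 0)"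
  \<comment> \<open>The expansion of \<open>f\<close> at \<open>p + t w\<close>: its coefficient of
    \<open>t ^ j\<close> is the homogeneous part of degree \<open>j\<close> of \<open>f\<close> at
    \<open>p\<close>, as a function of \<open>w\<close>.\<close>
  define \<sigma> where "\<sigma> = (\<lambda>t w (i::'i). (fst (p i) + t * fst (w i :: 'a \<times> 'a), snd (p i) + t * snd (w i)))"
  have "\<exists>n P. pp.poly_family I n P \<and> (\<forall>x t. fst (\<sigma> t x i) = poly (P x) t)"
    "\<exists>n P. pp.poly_family I n P \<and> (\<forall>x t. snd (\<sigma> t x i) = poly (P x) t)" if "i \<in> I" for i
    using poly_family_linear[OF point_polys.const point_polys.fst[OF that], of "fst (p i)"]
      poly_family_linear[OF point_polys.const point_polys.snd[OF that], of "snd (p i)"]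
    unfolding \<sigma>_def by fastforce+
  from point_polys_substitution[where \<sigma> = \<sigma>, OF this f(1)] obtain n P where
    P: "pp.poly_family I n P" "\<And>x t. f (\<sigma> t x) = poly (P x) t" by blast
  have "\<exists>j w. coeff (P w) j \<noteq> 0"
  proof -
    obtain x where "f x \<noteq> 0" using f(2) by blast
    moreover have "x = \<sigma> 1 (\<lambda>i. (fst (x i) - fst (p i), snd (x i) - snd (p i)))"
      by (auto simp: \<sigma>_def)
    ultimately have "poly (P (\<lambda>i. (fst (x i) - fst (p i), snd (x i) - snd (p i)))) 1 \<noteq> 0"
      using P(2) by metis
    then show ?thesis by (metis poly_0 poly_eq_iff coeff_0)
  qed
  \<comment> \<open>The lowest degree with a nonzero homogeneous part; the curve is then chosen in a
    direction \<open>v\<close> where that part is nonzero.\<close>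
  define k where "k = (LEAST j. \<exists>w. coeff (P w) j \<noteq> 0)"
  obtain v where v: "coeff (P v) k \<noteq> 0"
    using LeastI_ex[OF \<open>\<exists>j w. coeff (P w) j \<noteq> 0\<close>] unfolding k_def by blast
  have low: "coeff (P w) j = 0" if "j < k" for j w
    using not_less_Least[of j "\<lambda>j. \<exists>w. coeff (P w) j \<noteq> 0"] that unfolding k_def by blast
  obtain X Y where XY: "\<And>i. i \<in> I \<Longrightarrow> poly (X i) 0 = fst (p i) \<and> poly (Y i) 0 = snd (p i) \<and>
        poly (pderiv (X i)) 0 = fst (v i) \<and> poly (pderiv (Y i)) 0 = snd (v i)"
    "\<And>s. (\<lambda>i. (poly (X i) s, poly (Y i) s)) \<in> S" using curves[of v] by blast
  have tail: "\<exists>W. \<forall>s. poly Z s = poly Z 0 + s * poly W s" for Z :: "'a poly"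
    by (cases Z) (auto intro: exI)
  \<comment> \<open>The quotient of \<open>Z - Z(0)\<close> by the parameter. On \<open>I\<close>
    the curve then equals \<open>\<sigma> s (?w s)\<close>, and \<open>?w 0\<close> agrees with
    \<open>v\<close>.\<close>
  define tl where "tl = (\<lambda>Z :: 'a poly. SOME W. \<forall>s. poly Z s = poly Z 0 + s * poly W s)"
  have tl: "poly Z s = poly Z 0 + s * poly (tl Z) s" for Z s
    using someI_ex[OF tail[of Z]] unfolding tl_def by blast
  have der: "poly (pderiv Z) 0 = poly W 0" if "\<And>s. poly Z s = poly Z 0 + s * poly W s" for Z W :: "'a poly"
  proof -
    have "poly Z s = poly (pCons (poly Z 0) W) s" for s unfolding poly_pCons by (rule that)
    then have "poly Z = poly (pCons (poly Z 0) W)" by (rule ext)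
    then have "Z = pCons (poly Z 0) W" by (simp only: poly_eq_poly_eq_iff)
    then have "pderiv Z = pderiv (pCons (poly Z 0) W)" by (rule arg_cong)
    then show ?thesis by (simp add: pderiv_pCons)
  qed
  let ?w = "\<lambda>s i. (poly (tl (X i)) s, poly (tl (Y i)) s)"
  have "\<exists>q. \<forall>s. coeff (P (?w s)) j = poly q s" for j
    by (rule point_polys_along_curve[OF pp.poly_family_coeff[OF P(1)]])
  then obtain q where q: "\<And>j s. coeff (P (?w s)) j = poly (q j) s" by metis
  \<comment> \<open>The expansion along the curve vanishes for all \<open>s\<close>. In its
    coefficient of \<open>s ^ k\<close> the terms with \<open>j < k\<close> are zero and those with
    \<open>j > k\<close> carry too high a power, so only the value at \<open>v\<close>
    survives.\<close>
  have "poly (\<Sum>j<n. monom 1 j * q j) s = 0" for s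
  proof -
    have "0 = f (\<lambda>i. (poly (X i) s, poly (Y i) s))" using * XY(2) by metis
    also have "\<dots> = f (\<sigma> s (?w s))"
      by (rule point_polys_cong[OF f(1)]) (use XY(1) tl[of "X i" s for i] tl[of "Y i" s for i] in \<open>simp add: \<sigma>_def\<close>)
    also have "\<dots> = poly (P (?w s)) s" by (rule P)
    also have "\<dots> = (\<Sum>j<n. coeff (P (?w s)) j * s ^ j)"
      by (subst poly_as_sum_of_monoms'[of "P (?w s)" "n", symmetric])
       (use pp.poly_family_coeff_eq_0[OF P(1)] in
         \<open>auto intro: degree_le simp: poly_sum poly_monom atLeast0AtMost lessThan_Suc_atMost[symmetric]\<close>)
    also have "\<dots> = poly (\<Sum>j<n. monom 1 j * q j) s"
      by (simp add: q poly_sum poly_monom mult.commute)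
    finally show ?thesis by simp
  qed
  then have "(\<Sum>j<n. monom 1 j * q j) = 0" using poly_all_0_iff_0 by blast
  then have "0 = coeff (\<Sum>j<n. monom 1 j * q j) k" by simp
  also have "\<dots> = (\<Sum>j<n. if j = k then coeff (q k) 0 else 0)"
  proof -
    have "q j = 0" if "j < k" for j using q low[OF that] poly_all_0_iff_0 by metis
    then have "coeff (monom 1 j * q j) k = (if j = k then coeff (q k) 0 else 0)" for j
      by (cases j k rule: linorder_cases) (simp_all add: coeff_monom_mult)
    then show ?thesis by (simp only: coeff_sum)
  qed
  also have "\<dots> = coeff (q k) 0"
    using v pp.poly_family_coeff_eq_0[OF P(1), of k v] by (auto simp: not_less[symmetric])
  also have "\<dots> = coeff (P (?w 0)) k" unfolding q by (rule poly_0_coeff_0[symmetric])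
  also have "\<dots> = coeff (P v) k"
    by (rule point_polys_cong[OF pp.poly_family_coeff[OF P(1)]])
      (use XY(1) der[OF tl] in \<open>simp add: prod_eq_iff\<close>)
  finally show False using v by simp
qed

section \<open>Velocities of curves in the group\<close>

text \<open>
  \<open>None\<close> encodes \<open>H 1\<close> and \<open>Some d\<close> encodes \<open>K d\<close>. Words over \<open>'a poly\<close> are polynomial curves of
  words, acting on polynomial curves in the plane.
\<close>

definition shear :: "nat option \<Rightarrow> 'r::comm_ring_1 \<Rightarrow> 'r \<times> 'r \<Rightarrow> 'r \<times> 'r" where
  "shear l a z = (case l of None \<Rightarrow> (fst z + a * snd z, snd z) | Some d \<Rightarrow> (fst z, snd z + a * fst z ^ d))"

primrec act :: "(nat option \<times> 'r::comm_ring_1) list \<Rightarrow> 'r \<times> 'r \<Rightarrow> 'r \<times> 'r" where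
  "act [] z = z"
| "act (la # w) z = shear (fst la) (snd la) (act w z)"

lemma act_append: "act (v @ w) z = act v (act w z)"
  by (induction v) auto

lemma shear_minus: "shear l a (shear l (- a) z) = z" "shear l (- a) (shear l a z) = z"
  by (auto simp: shear_def split: option.split)

definition eval_curve :: "'a::comm_ring_1 poly \<times> 'a poly \<Rightarrow> 'a \<Rightarrow> 'a \<times> 'a" where
  "eval_curve z s = (poly (fst z) s, poly (snd z) s)"

definition velocity :: "'a::idom poly \<times> 'a poly \<Rightarrow> 'a \<times> 'a" where
  "velocity z = (poly (pderiv (fst z)) 0, poly (pderiv (snd z)) 0)"

lemma eval_curve_shear: "eval_curve (shear l a z) s = shear l (poly a s) (eval_curve z s)"
  by (simp add: eval_curve_def shear_def split: option.split)

lemma eval_curve_act: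
  "eval_curve (act w z) s = act (map (\<lambda>(l, a). (l, poly a s)) w) (eval_curve z s)"
  by (induction w) (auto simp: eval_curve_shear)

text \<open>Substituting \<open>c s\<close> for the parameter multiplies the velocity by
  \<open>c\<close> and keeps the letters.\<close>

definition reparam :: "'a::comm_ring_1 \<Rightarrow> (nat option \<times> 'a poly) list \<Rightarrow> (nat option \<times> 'a poly) list" where
  "reparam c w = map (\<lambda>(l, a). (l, pcompose a [:0, c:])) w"

lemma reparam_append: "reparam c (v @ w) = reparam c v @ reparam c w"
  by (simp add: reparam_def)

lemma reparam_reparam: "reparam b (reparam c w) = reparam (b * c) w"
  by (simp add: reparam_def pcompose_assoc[symmetric] pcompose_pCons mult.commute split: prod.split)

lemma reparam_Nil: "reparam c [] = []"
  and reparam_Cons: "reparam c ((l, a) # w) = (l, pcompose a [:0, c:]) # reparam c w"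
  by (simp_all add: reparam_def)

lemma map_fst_reparam: "map fst (reparam c w) = map fst w"
  by (auto simp: reparam_def)

text \<open>
  The curve of words starts at the identity and has the vector field \<open>X\<close> as its velocity; the
  clause for all reparametrisations makes the notion linear in \<open>X\<close>.
\<close>

definition realizes :: "(nat option \<times> 'a::field_char_0 poly) list \<Rightarrow> ('a \<times> 'a \<Rightarrow> 'a \<times> 'a) \<Rightarrow> bool" where
  "realizes w X \<longleftrightarrow> (\<forall>c z. eval_curve (act (reparam c w) z) 0 = eval_curve z 0 \<and>
     velocity (act (reparam c w) z) =
       (fst (velocity z) + c * fst (X (eval_curve z 0)), snd (velocity z) + c * snd (X (eval_curve z 0))))"

lemma realizesD:
  assumes "realizes w X"
  shows "eval_curve (act (reparam c w) z) 0 = eval_curve z 0"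
    and "velocity (act (reparam c w) z) =
       (fst (velocity z) + c * fst (X (eval_curve z 0)), snd (velocity z) + c * snd (X (eval_curve z 0)))"
  using assms unfolding realizes_def by blast+

lemma realizes_Nil: "realizes [] (\<lambda>_. (0, 0))"
  by (simp add: realizes_def reparam_def)

text \<open>Both curves start at the identity, so composing them adds the velocities.\<close>

lemma realizes_append:
  assumes "realizes v X" "realizes w Y"
  shows "realizes (v @ w) (\<lambda>z. (fst (X z) + fst (Y z), snd (X z) + snd (Y z)))"
  unfolding realizes_def
  by (simp add: reparam_append act_append realizesD[OF assms(1)] realizesD[OF assms(2)] algebra_simps)

lemma realizes_reparam:
  assumes "realizes w X"
  shows "realizes (reparam c w) (\<lambda>z. (c * fst (X z), c * snd (X z)))"
  unfolding realizes_def by (simp add: reparam_reparam realizesD[OF assms] mult.assoc)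

lemma realizes_K: "realizes [(Some d, [:0, 1:])] (\<lambda>(x, y). (0, x ^ d))"
  by (auto simp: realizes_def reparam_def shear_def eval_curve_def velocity_def pcompose_pCons
      pderiv_add pderiv_mult pderiv_pCons)

text \<open>Conjugation by a constant shear pushes the field forward: it is evaluated at the
  preimage and multiplied by the Jacobian matrix of the shear.\<close>

lemma realizes_conj_H:
  assumes "realizes w X"
  shows "realizes ((None, [:a:]) # w @ [(None, [:- a:])])
    (\<lambda>(x, y). (fst (X (x - a * y, y)) + a * snd (X (x - a * y, y)), snd (X (x - a * y, y))))"
proof -
  have 1: "eval_curve (shear None [:b:] z) 0 = (fst (eval_curve z 0) + b * snd (eval_curve z 0), snd (eval_curve z 0))"
    "velocity (shear None [:b:] z) = (fst (velocity z) + b * snd (velocity z), snd (velocity z))"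
    for b :: 'a and z
    by (auto simp: shear_def eval_curve_def velocity_def pderiv_add pderiv_smult)
  show ?thesis
    unfolding realizes_def
    by (simp add: reparam_Cons reparam_append act_append reparam_Nil 1 realizesD[OF assms]
        case_prod_unfold algebra_simps)
qed

text \<open>Push-forward again, with a Jacobian that depends on \<open>x\<close>. For
  \<open>d = 0\<close> the truncated exponent \<open>d - 1\<close> is harmless because the factor
  \<open>of_nat d\<close> vanishes.\<close>

lemma realizes_conj_K:
  assumes "realizes w X"
  shows "realizes ((Some d, [:a:]) # w @ [(Some d, [:- a:])])
    (\<lambda>(x, y). (fst (X (x, y - a * x ^ d)),
       snd (X (x, y - a * x ^ d)) + a * of_nat d * x ^ (d - 1) * fst (X (x, y - a * x ^ d))))"
proof -
  have 1: "eval_curve (shear (Some d) [:b:] z) 0 =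
      (fst (eval_curve z 0), snd (eval_curve z 0) + b * fst (eval_curve z 0) ^ d)"
    "velocity (shear (Some d) [:b:] z) =
      (fst (velocity z), snd (velocity z) + b * of_nat d * fst (eval_curve z 0) ^ (d - 1) * fst (velocity z))"
    for b :: 'a and z
    by (auto simp: shear_def eval_curve_def velocity_def pderiv_add pderiv_smult pderiv_power)
  show ?thesis
    unfolding realizes_def
    by (simp add: reparam_Cons reparam_append act_append reparam_Nil 1 realizesD[OF assms]
        case_prod_unfold algebra_simps)
qed

definition tangent_field :: "nat option set \<Rightarrow> ('a::field_char_0 \<times> 'a \<Rightarrow> 'a \<times> 'a) \<Rightarrow> bool" where
  "tangent_field L X \<longleftrightarrow> (\<exists>w. fst ` set w \<subseteq> L \<and> realizes w X)"

lemma tangent_field_add: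
  "tangent_field L X \<Longrightarrow> tangent_field L Y \<Longrightarrow>
     tangent_field L (\<lambda>z. (fst (X z) + fst (Y z), snd (X z) + snd (Y z)))"
  unfolding tangent_field_def
proof (elim exE conjE)
  fix v w
  assume "fst ` set v \<subseteq> L" "realizes v X" "fst ` set w \<subseteq> L" "realizes w Y"
  then show "\<exists>u. fst ` set u \<subseteq> L \<and> realizes u (\<lambda>z. (fst (X z) + fst (Y z), snd (X z) + snd (Y z)))"
    by (intro exI[of _ "v @ w"] conjI realizes_append) auto
qed

lemma tangent_field_scale:
  "tangent_field L X \<Longrightarrow> tangent_field L (\<lambda>z. (c * fst (X z), c * snd (X z)))"
  unfolding tangent_field_def
proof (elim exE conjE)
  fix w
  assume "fst ` set w \<subseteq> L" "realizes w X"
  then show "\<exists>u. fst ` set u \<subseteq> L \<and> realizes u (\<lambda>z. (c * fst (X z), c * snd (X z)))"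
    by (intro exI[of _ "reparam c w"] conjI realizes_reparam) (auto simp: reparam_def)
qed

lemma tangent_field_K: "Some d \<in> L \<Longrightarrow> tangent_field L (\<lambda>(x, y). (0, x ^ d))"
  unfolding tangent_field_def by (rule exI[of _ "[(Some d, [:0, 1:])]"]) (simp add: realizes_K)

lemma tangent_field_conj_H:
  assumes "None \<in> L" "tangent_field L X"
  shows "tangent_field L
    (\<lambda>(x, y). (fst (X (x - a * y, y)) + a * snd (X (x - a * y, y)), snd (X (x - a * y, y))))"
proof -
  obtain w where "fst ` set w \<subseteq> L" "realizes w X" using assms by (auto simp: tangent_field_def)
  then show ?thesis unfolding tangent_field_def
    by (intro exI conjI, rule_tac[2] realizes_conj_H) (use assms in auto)
qed

lemma tangent_field_conj_K:
  assumes "Some d \<in> L" "tangent_field L X"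
  shows "tangent_field L
    (\<lambda>(x, y). (fst (X (x, y - a * x ^ d)),
       snd (X (x, y - a * x ^ d)) + a * of_nat d * x ^ (d - 1) * fst (X (x, y - a * x ^ d))))"
proof -
  obtain w where "fst ` set w \<subseteq> L" "realizes w X" using assms by (auto simp: tangent_field_def)
  then show ?thesis unfolding tangent_field_def
    by (intro exI conjI, rule_tac[2] realizes_conj_K) (use assms in auto)
qed

text \<open>
  Substituting \<open>2a\<close> for \<open>a\<close> and subtracting \<open>2\<^sup>n\<close> times the original removes the leading term.
\<close>

lemma coeffs_in_subspace:
  fixes A B :: "'b \<Rightarrow> 'a::field_char_0 poly" and V :: "('b \<Rightarrow> 'a \<times> 'a) set"
  assumes add: "\<And>X Y. X \<in> V \<Longrightarrow> Y \<in> V \<Longrightarrow> (\<lambda>z. (fst (X z) + fst (Y z), snd (X z) + snd (Y z))) \<in> V"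
    and scale: "\<And>c X. X \<in> V \<Longrightarrow> (\<lambda>z. (c * fst (X z), c * snd (X z))) \<in> V"
    and V: "\<And>a. (\<lambda>z. (poly (A z) a, poly (B z) a)) \<in> V"
    and bound: "\<And>z. degree (A z) \<le> n" "\<And>z. degree (B z) \<le> n"
    and "j \<le> n"
  shows "(\<lambda>z. (coeff (A z) j, coeff (B z) j)) \<in> V"
  using V bound \<open>j \<le> n\<close>
proof (induction n arbitrary: A B j)
  case 0
  then have "A z = [:coeff (A z) 0:]" "B z = [:coeff (B z) 0:]" for z
    by (metis degree_0_id le_zero_eq)+
  then show ?case using 0(1)[of 0] 0 by (simp add: poly_0_coeff_0)
next
  case (Suc n)
  have zero: "(\<lambda>z. (0, 0)) \<in> V" using scale[OF Suc.prems(1)[of 0], of 0] by simp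
  have low: "(\<lambda>z. (coeff (A z) i, coeff (B z) i)) \<in> V" if "i \<le> n" for i
  proof -
    let ?T = "\<lambda>P. pcompose P [:0, 2:] - smult (2 ^ Suc n) P :: 'a poly"
    have deg: "degree (?T P) \<le> n" if "degree P \<le> Suc n" for P
    proof (rule degree_le, intro allI impI)
      fix i assume "n < i"
      then show "coeff (?T P) i = 0"
        using that by (cases "i = Suc n") (auto simp: coeff_pcompose_linear coeff_eq_0)
    qed
    have "(\<lambda>z. (poly (?T (A z)) a, poly (?T (B z)) a)) \<in> V" for a
      using add[OF Suc.prems(1)[of "2 * a"] scale[OF Suc.prems(1)[of a], of "- (2 ^ Suc n)"]]
      by (simp add: poly_pcompose mult.commute)
    then have "(\<lambda>z. (coeff (?T (A z)) i, coeff (?T (B z)) i)) \<in> V"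
      by (rule Suc.IH) (use deg Suc.prems that in auto)
    moreover have "coeff (?T P) i = (2 ^ i - 2 ^ Suc n) * coeff P i" for P
      by (simp add: coeff_pcompose_linear algebra_simps)
    ultimately have "(\<lambda>z. ((2 ^ i - 2 ^ Suc n) * coeff (A z) i, (2 ^ i - 2 ^ Suc n) * coeff (B z) i)) \<in> V"
      by simp
    from scale[OF this, of "inverse (2 ^ i - 2 ^ Suc n)"]
    have "(\<lambda>z. (inverse (2 ^ i - 2 ^ Suc n) * ((2 ^ i - 2 ^ Suc n) * coeff (A z) i),
        inverse (2 ^ i - 2 ^ Suc n) * ((2 ^ i - 2 ^ Suc n) * coeff (B z) i))) \<in> V" by simp
    \<comment> \<open>Powers of 2 with different exponents stay different in characteristic zero, so
      the factor can be inverted.\<close>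
    moreover have "(2 :: 'a) ^ i - 2 ^ Suc n \<noteq> 0"
    proof -
      have "(2 :: nat) ^ i \<noteq> 2 ^ Suc n" using that by (subst power_inject_exp) auto
      then have "(of_nat (2 ^ i) :: 'a) \<noteq> of_nat (2 ^ Suc n)" by (simp only: of_nat_eq_iff not_False_eq_True)
      then show ?thesis by simp
    qed
    ultimately show ?thesis by (simp add: mult.assoc[symmetric])
  qed
  show ?case
  proof (cases "j \<le> n")
    case False
    with Suc.prems have j: "j = Suc n" by simp
    \<comment> \<open>The value at 1 is the sum of all coefficients; subtracting the lower ones
      leaves the top coefficient.\<close>
    have "(\<lambda>z. (\<Sum>i<k. coeff (A z) i, \<Sum>i<k. coeff (B z) i)) \<in> V" if "k \<le> Suc n" for k
      using that
    proof (induction k)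
      case (Suc k)
      then show ?case using add[OF Suc.IH low[of k]] by simp
    qed (simp add: zero)
    from add[OF Suc.prems(1)[of 1] scale[OF this[OF order_refl], of "- 1"]]
    have "(\<lambda>z. (poly (A z) 1 - (\<Sum>i<Suc n. coeff (A z) i), poly (B z) 1 - (\<Sum>i<Suc n. coeff (B z) i))) \<in> V"
      by (simp del: sum.lessThan_Suc)
    moreover have "poly P 1 - (\<Sum>i<Suc n. coeff P i) = coeff P (Suc n)" if "degree P \<le> Suc n" for P :: "'a poly"
    proof -
      have "poly P 1 = (\<Sum>i\<le>Suc n. coeff P i)"
        using poly_as_sum_of_monoms'[OF that] by (metis (no_types, lifting) mult.right_neutral
            poly_monom poly_sum power_one sum.cong)
      then show ?thesis by (simp add: lessThan_Suc_atMost)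
    qed
    ultimately show ?thesis using Suc.prems j by simp
  qed (use low in auto)
qed

section \<open>Tangent fields with all large powers of x\<close>

lemma tangent_field_raise:
  assumes L: "None \<in> L" "Some d \<in> L" "d \<ge> 1" and "N \<ge> 1"
    and X: "tangent_field L (\<lambda>(x, y). (0, x ^ N :: 'a::field_char_0))"
  shows "tangent_field L (\<lambda>(x, y). (0, x ^ (N + (d - 1)) :: 'a))"
proof -
  \<comment> \<open>The part of the \<open>H 1\<close>-conjugates that is linear in the parameter is
    \<open>(x ^ N, - N x ^ (N - 1) y)\<close>; conjugating it by \<open>K d\<close> changes it by a multiple of the goal.\<close>
  define A B where "A = (\<lambda>(x :: 'a, y). [:0, 1:] * [:x, - y:] ^ N)" and "B = (\<lambda>(x :: 'a, y). [:x, - y:] ^ N)"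
  \<comment> \<open>The components are polynomials in the conjugation parameter \<open>a\<close>,
    with \<open>[:x, - y:]\<close> standing for \<open>x - a * y\<close>.\<close>
  have "tangent_field L (\<lambda>z. (poly (A z) a, poly (B z) a))" for a
    using tangent_field_conj_H[OF L(1) X, of a]
    by (simp add: A_def B_def case_prod_unfold)
  moreover have degB: "degree (B z) \<le> N" for z
  proof -
    have "degree ([:fst z, - snd z:] ^ N) \<le> degree [:fst z, - snd z:] * N" by (rule degree_power_le)
    also have "\<dots> \<le> N" by simp
    finally show ?thesis by (simp add: B_def case_prod_unfold)
  qed
  moreover have degA: "degree (A z) \<le> Suc N" for z
  proof -
    have "A z = [:0, 1:] * B z" by (simp add: A_def B_def case_prod_unfold)
    then show ?thesis using degree_mult_le[of "[:0, 1:]" "B z"] degB[of z] by simp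
  qed
  ultimately have "(\<lambda>z. (coeff (A z) 1, coeff (B z) 1)) \<in> Collect (tangent_field L)"
    by (intro coeffs_in_subspace[where n = "Suc N"])
      (auto intro: tangent_field_add tangent_field_scale le_SucI)
  then have AB: "tangent_field L (\<lambda>z. (coeff (A z) 1, coeff (B z) 1))" by simp
 have "coeff (B (x, y)) 1 = - (of_nat N * x ^ (N - 1) * y)" for x y
    using coeff_pderiv[of "B (x, y)" 0]
    by (simp add: B_def pderiv_power pderiv_pCons mult_ac flip: poly_0_coeff_0)
  moreover have "coeff (A (x, y)) 1 = x ^ N" for x y
    by (simp add: A_def coeff_pCons flip: poly_0_coeff_0)
  ultimately have "(\<lambda>z. (coeff (A z) 1, coeff (B z) 1)) =
      (\<lambda>(x, y). (x ^ N, - (of_nat N * x ^ (N - 1) * y)))"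
    by (auto simp: fun_eq_iff)
  with AB have Y: "tangent_field L (\<lambda>(x :: 'a, y). (x ^ N, - (of_nat N * x ^ (N - 1) * y)))" by simp
  from tangent_field_conj_K[OF L(2) Y, of 1]
  have "tangent_field L (\<lambda>(x :: 'a, y). (x ^ N, - (of_nat N * x ^ (N - 1) * (y - x ^ d)) + of_nat d * x ^ (d - 1) * x ^ N))"
    by (simp add: case_prod_unfold)
  \<comment> \<open>The difference between the conjugate and \<open>Y\<close> has first component
    zero; its second is \<open>(N + d) x ^ (N + d - 1)\<close>, up to sign the Lie bracket of
    \<open>Y\<close> with \<open>(0, x ^ d)\<close>.\<close>
  from tangent_field_add[OF this tangent_field_scale[OF Y, of "- 1"]]
  have "tangent_field L (\<lambda>(x :: 'a, y). (0, of_nat N * x ^ (N - 1) * x ^ d + of_nat d * x ^ (d - 1) * x ^ N))"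
    by (simp add: case_prod_unfold algebra_simps)
  moreover have "of_nat N * x ^ (N - 1) * x ^ d + of_nat d * x ^ (d - 1) * x ^ N
      = of_nat (N + d) * x ^ (N + (d - 1))" for x :: 'a
  proof -
    have "N - 1 + d = N + (d - 1)" "d - 1 + N = N + (d - 1)" using assms by auto
    then have "x ^ (N - 1) * x ^ d = x ^ (N + (d - 1))" "x ^ (d - 1) * x ^ N = x ^ (N + (d - 1))"
      by (metis power_add)+
    then show ?thesis by (simp only: mult.assoc of_nat_add distrib_right)
  qed
  ultimately have "tangent_field L (\<lambda>(x :: 'a, y). (0, of_nat (N + d) * x ^ (N + (d - 1))))" by simp
  moreover have nz: "of_nat (N + d) \<noteq> (0 :: 'a)"
    using \<open>N \<ge> 1\<close> by (simp del: of_nat_add)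
  ultimately show ?thesis
    using tangent_field_scale[of L "\<lambda>(x, y). (0, of_nat (N + d) * x ^ (N + (d - 1)) :: 'a)" "inverse (of_nat (N + d))"]
    by (simp add: case_prod_unfold mult.assoc[symmetric] del: of_nat_add)
qed

text \<open>Two consecutive elements \<open>b\<close> and \<open>b + 1\<close> already generate
  every number from \<open>b * b\<close> on. The divisibility condition forces such a pair; its
  instance \<open>g = 0\<close> excludes \<open>M = {0}\<close>.\<close>

lemma numerical_semigroup_cofinite:
  fixes M :: "nat set"
  assumes "0 \<in> M" and add: "\<And>a b. a \<in> M \<Longrightarrow> b \<in> M \<Longrightarrow> a + b \<in> M"
    and gcd: "\<And>g. (\<And>a. a \<in> M \<Longrightarrow> g dvd a) \<Longrightarrow> g dvd 1"
  shows "\<exists>n0. \<forall>n\<ge>n0. n \<in> M"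
proof -
  define D where "D = {int a - int b | a b. a \<in> M \<and> b \<in> M}"
  have mult: "k * a \<in> M" if "a \<in> M" for k a using that by (induction k) (auto simp: assms)
  have D_diff: "u - v \<in> D" if uv: "u \<in> D" "v \<in> D" for u v
  proof -
    obtain a b a' b' where "u = int a - int b" "v = int a' - int b'" "a \<in> M" "b \<in> M" "a' \<in> M" "b' \<in> M"
      using uv unfolding D_def by blast
    then have "u - v = int (a + b') - int (b + a')" "a + b' \<in> M" "b + a' \<in> M" by (auto intro: add)
    then show ?thesis unfolding D_def by blast
  qed
  have D_mult: "int k * u \<in> D" if u: "u \<in> D" for k u
  proof -
    obtain a b where "u = int a - int b" "a \<in> M" "b \<in> M" using u unfolding D_def by blast
    then have "int k * u = int (k * a) - int (k * b)" "k * a \<in> M" "k * b \<in> M"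
      by (auto intro: mult simp: right_diff_distrib)
    then show ?thesis unfolding D_def by blast
  qed
  have MD: "int a \<in> D" if "a \<in> M" for a using that \<open>0 \<in> M\<close> by (force simp: D_def)
  have "\<exists>a\<in>M. a \<noteq> 0"
  proof (rule ccontr)
    assume "\<not> (\<exists>a\<in>M. a \<noteq> 0)"
    then have "0 dvd a" if "a \<in> M" for a using that by auto
    from gcd[OF this] show False by simp
  qed
  then have ex: "\<exists>g. g > 0 \<and> int g \<in> D" using MD by blast
  \<comment> \<open>Division with remainder makes the least positive difference a common divisor of
    \<open>M\<close>, hence 1.\<close>
  define g where "g = (LEAST g. g > 0 \<and> int g \<in> D)"
  have g: "g > 0" "int g \<in> D" using LeastI_ex[OF ex] by (auto simp: g_def)
  have "g dvd a" if "a \<in> M" for a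
  proof -
    have "int (a mod g) = int a - int (a div g) * int g"
      by (simp only: zmod_int zdiv_int minus_div_mult_eq_mod)
    then have "int (a mod g) \<in> D" using D_diff[OF MD[OF that] D_mult[OF g(2)]] by simp
    moreover have "a mod g < g" using g by simp
    ultimately have "a mod g = 0" using not_less_Least[of "a mod g" "\<lambda>g. g > 0 \<and> int g \<in> D"]
      by (simp add: g_def)
    then show ?thesis by auto
  qed
  from gcd[OF this] have "g = 1" by simp
  then have "1 \<in> D" using g(2) by simp
  then obtain a b where "1 = int a - int b" "a \<in> M" "b \<in> M" unfolding D_def by blast
  then have ab: "a \<in> M" "b \<in> M" "a = b + 1" by linarith+
  have "n \<in> M" if "n \<ge> b * b" for n
  proof (cases "b = 0")
    case True
    then show ?thesis using mult[OF ab(1), of n] ab by simp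
  next
    case False
    then have "b \<le> n div b" using div_le_mono[OF that, of b] by simp
    moreover have "n mod b < b" using False by simp
    ultimately have r: "n mod b \<le> n div b" by linarith
    \<comment> \<open>With quotient \<open>q\<close> and remainder \<open>r\<close> modulo
      \<open>b\<close>, this is \<open>n = (q - r) b + r (b + 1)\<close>; the bound
      \<open>b * b\<close> ensures \<open>r \<le> q\<close>.\<close>
    have "n = (n div b - n mod b) * b + (n mod b) * a"
    proof -
      have "(n div b - n mod b) * b + (n mod b) * a = (n div b - n mod b + n mod b) * b + n mod b"
        by (simp add: ab(3) algebra_simps)
      then show ?thesis using r by simp
    qed
    then show ?thesis using add[OF mult[OF ab(2)] mult[OF ab(1)]] by metis
  qed
  then show ?thesis by blast
qed

lemma tangent_field_powers:
  assumes "None \<in> L" "Some d \<in> L" and pos: "\<And>e. Some e \<in> L \<Longrightarrow> e \<ge> 1"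
    and gcd: "\<And>g. (\<And>e. Some e \<in> L \<Longrightarrow> g dvd e - 1) \<Longrightarrow> g dvd 1"
  shows "\<exists>N0. \<forall>N\<ge>N0. tangent_field L (\<lambda>(x, y). (0, x ^ N :: 'a::field_char_0))"
proof -
  define T where "T = (\<lambda>N. tangent_field L (\<lambda>(x, y). (0, x ^ N :: 'a)))"
  \<comment> \<open>The admissible increments of the exponent form an additive monoid that contains
    every \<open>e - 1\<close>. They are applied to the starting exponent \<open>d\<close>.\<close>
  define M where "M = {k. \<forall>N\<ge>1. T N \<longrightarrow> T (N + k)}"
  have M: "e - 1 \<in> M" if "Some e \<in> L" for e
    unfolding M_def T_def
    by (intro CollectI allI impI tangent_field_raise) (use assms that in auto)
  have "\<exists>n0. \<forall>n\<ge>n0. n \<in> M"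
  proof (rule numerical_semigroup_cofinite)
    show "a + b \<in> M" if "a \<in> M" "b \<in> M" for a b
    proof -
      have "T (N + (a + b))" if "N \<ge> 1" "T N" for N
      proof -
        have "T (N + a)" using \<open>a \<in> M\<close> that by (simp add: M_def)
        then have "T (N + a + b)" using \<open>b \<in> M\<close> that by (simp add: M_def)
        then show ?thesis by (simp add: add.assoc)
      qed
      then show ?thesis by (simp add: M_def)
    qed
    show "g dvd 1" if "\<And>a. a \<in> M \<Longrightarrow> g dvd a" for g
      using gcd that M by blast
  qed (simp add: M_def)
  then obtain n0 where n0: "\<And>n. n \<ge> n0 \<Longrightarrow> n \<in> M" by blast
  have "T d" using tangent_field_K[OF assms(2)] by (simp add: T_def)
  have "T N" if "N \<ge> d + n0" for N
  proof -
    have "N - d \<in> M" using n0 that by simp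
    then have "T (d + (N - d))" using \<open>T d\<close> pos[OF assms(2)] by (auto simp: M_def)
    then show ?thesis using that by simp
  qed
  then show ?thesis unfolding T_def by blast
qed

section \<open>Prescribed velocities at finitely many points\<close>

lemma tangent_field_poly:
  assumes "\<forall>N\<ge>N0. tangent_field L (\<lambda>(x, y). (0, x ^ N :: 'a::field_char_0))"
  shows "tangent_field L (\<lambda>(x, y). (0, x ^ N0 * poly q x :: 'a))"
  using assms
proof (induction q arbitrary: N0)
  case 0
  show ?case using tangent_field_scale[OF 0[rule_format, of N0], of 0] by (simp add: case_prod_unfold)
next
  case (pCons c q)
  have "tangent_field L (\<lambda>(x, y). (0, x ^ Suc N0 * poly q x))"
    by (rule pCons.IH) (use pCons.prems in auto)
  from tangent_field_add[OF tangent_field_scale[OF pCons.prems[rule_format, of N0], of c] this]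
  show ?case by (simp add: case_prod_unfold algebra_simps)
qed

text \<open>Lagrange interpolation, normalised against \<open>c\<close>, which will be the value
  \<open>t i ^ N0\<close> of the obligatory factor.\<close>

lemma interpolation_poly:
  fixes t :: "'i \<Rightarrow> 'a::field"
  assumes "finite I" "i \<in> I" "inj_on t I" and "c \<noteq> 0"
  shows "\<exists>q. c * poly q (t i) = 1 \<and> (\<forall>j\<in>I - {i}. poly q (t j) = 0)"
proof -
  define r where "r = (\<Prod>j\<in>I - {i}. [:- t j, 1:])"
  have "poly r (t i) \<noteq> 0"
    using assms by (auto simp: r_def poly_prod inj_on_def)
  then have "c * poly (smult (inverse (c * poly r (t i))) r) (t i) = 1"
      using \<open>c \<noteq> 0\<close> by (simp add: field_simps)
  moreover have "poly (smult k r) (t j) = 0" if "j \<in> I - {i}" for j k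
    using that assms(1) by (force simp: r_def poly_prod)
  ultimately show ?thesis by blast
qed

text \<open>
  The conjugates by \<open>H 1\<close> are the fields \<open>f (x - a y) (a, 1)\<close>, where \<open>f\<close> may be any polynomial
  divisible by \<open>t ^ N0\<close>.
\<close>

lemma tangent_field_delta:
  fixes p :: "'i \<Rightarrow> 'a::field_char_0 \<times> 'a"
  assumes "None \<in> L" and N0: "\<forall>N\<ge>N0. tangent_field L (\<lambda>(x, y). (0, x ^ N :: 'a))"
    and "finite I" "i \<in> I"
    and a: "inj_on (\<lambda>j. fst (p j) - a * snd (p j)) I" "\<forall>j\<in>I. fst (p j) - a * snd (p j) \<noteq> 0"
  shows "\<exists>X. tangent_field L X \<and> X (p i) = (a, 1) \<and> (\<forall>j\<in>I - {i}. X (p j) = (0, 0))"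
proof -
  define t where "t = (\<lambda>j. fst (p j) - a * snd (p j))"
  obtain q where q: "t i ^ N0 * poly q (t i) = 1" "\<And>j. j \<in> I - {i} \<Longrightarrow> poly q (t j) = 0"
    using interpolation_poly[of I i t "t i ^ N0"] assms by (auto simp: t_def)
  from tangent_field_conj_H[OF assms(1) tangent_field_poly[OF N0, of q], of a]
  have "tangent_field L (\<lambda>(x, y). (a * ((x - a * y) ^ N0 * poly q (x - a * y)),
      (x - a * y) ^ N0 * poly q (x - a * y)))"
    by (simp add: case_prod_unfold)
  moreover have "t i ^ N0 * poly q (t i) = 1" "\<forall>j\<in>I - {i}. poly q (t j) = 0" using q by auto
  ultimately show ?thesis
    by (intro exI[of _ "\<lambda>(x, y). (a * ((x - a * y) ^ N0 * poly q (x - a * y)),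
        (x - a * y) ^ N0 * poly q (x - a * y))"]) (auto simp: case_prod_unfold t_def)
qed

text \<open>Each nonzero point and each difference of two distinct points rules out at most one
  slope, and the field is infinite. The set \<open>F\<close> allows a second, different slope to be
  chosen.\<close>

lemma exists_separating_slope:
  fixes p :: "'i \<Rightarrow> 'a::field_char_0 \<times> 'a"
  assumes "finite I" "inj_on p I" "(0, 0) \<notin> p ` I" "finite F"
  shows "\<exists>a. a \<notin> F \<and> inj_on (\<lambda>j. fst (p j) - a * snd (p j)) I \<and>
    (\<forall>j\<in>I. fst (p j) - a * snd (p j) \<noteq> 0)"
proof -
  define B where "B = (\<lambda>v :: 'a \<times> 'a. {a. fst v - a * snd v = 0})"
  have finB: "finite (B v)" if "v \<noteq> (0, 0)" for v
  proof (cases "snd v = 0")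
    case True
    then have "B v = {}" using that by (auto simp: B_def prod_eq_iff)
    then show ?thesis by simp
  next
    case False
    then have "B v \<subseteq> {fst v / snd v}" by (auto simp: B_def field_simps)
    then show ?thesis by (rule finite_subset) simp
  qed
  let ?d = "\<lambda>i j. (fst (p i) - fst (p j), snd (p i) - snd (p j))"
  have "finite (F \<union> (\<Union>j\<in>I. B (p j)) \<union> (\<Union>i\<in>I. \<Union>j\<in>I - {i}. B (?d i j)))"
  proof (intro finite_UnI finite_UN_I finB)
    fix j assume "j \<in> I"
    then show "p j \<noteq> (0, 0)" using assms(3) by force
  next
    fix i j assume "i \<in> I" "j \<in> I - {i}"
    then have "p i \<noteq> p j" using assms(2) by (auto simp: inj_on_def)
    then show "?d i j \<noteq> (0, 0)" by (auto simp: prod_eq_iff)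
  qed (use assms in auto)
  then obtain a where a: "a \<notin> F \<union> (\<Union>j\<in>I. B (p j)) \<union> (\<Union>i\<in>I. \<Union>j\<in>I - {i}. B (?d i j))"
    by (elim exE[OF ex_new_if_finite[OF infinite_UNIV_char_0]])
  have "inj_on (\<lambda>j. fst (p j) - a * snd (p j)) I"
  proof (rule inj_onI, rule ccontr)
    fix i j assume ij: "i \<in> I" "j \<in> I" "i \<noteq> j"
      and eq: "fst (p i) - a * snd (p i) = fst (p j) - a * snd (p j)"
    then have "a \<in> B (?d i j)" by (simp add: B_def algebra_simps)
    then show False using a ij by blast
  qed
  moreover have "fst (p j) - a * snd (p j) \<noteq> 0" if "j \<in> I" for j
    using a that by (auto simp: B_def)
  ultimately show ?thesis using a by blast
qed

text \<open>
  One sequence of letters has to serve all velocities, because only the image of a fixed sequence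
  is known to be constructible.
\<close>

lemma realizes_all_velocities:
  fixes p :: "'i \<Rightarrow> 'a::field_char_0 \<times> 'a"
  assumes "None \<in> L" and N0: "\<forall>N\<ge>N0. tangent_field L (\<lambda>(x, y). (0, x ^ N :: 'a))"
    and I: "finite I" "inj_on p I" "(0, 0) \<notin> p ` I"
  shows "\<exists>\<pi>. set \<pi> \<subseteq> L \<and>
    (\<forall>v. \<exists>w X. map fst w = \<pi> \<and> realizes w X \<and> (\<forall>i\<in>I. X (p i) = v i))"
proof -
  \<comment> \<open>Two different slopes give the vectors \<open>(a, 1)\<close> and
    \<open>(b, 1)\<close>, a basis of the plane.\<close>
  obtain a where a: "inj_on (\<lambda>j. fst (p j) - a * snd (p j)) I" "\<forall>j\<in>I. fst (p j) - a * snd (p j) \<noteq> 0"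
    using exists_separating_slope[OF I finite.emptyI] by blast
  obtain b where b: "inj_on (\<lambda>j. fst (p j) - b * snd (p j)) I" "\<forall>j\<in>I. fst (p j) - b * snd (p j) \<noteq> 0"
    and "b \<noteq> a"
    using exists_separating_slope[OF I, of "{a}"] by auto
  have "\<exists>\<pi>. set \<pi> \<subseteq> L \<and> (\<forall>v. \<exists>w X. map fst w = \<pi> \<and> realizes w X \<and>
      (\<forall>i\<in>I. X (p i) = (if i \<in> J then v i else (0, 0))))" if "finite J" "J \<subseteq> I" for J
    using that
  proof (induction J)
    case empty
    show ?case by (intro exI[of _ "[]"] conjI allI exI[of _ "\<lambda>_. (0, 0)"]) (auto simp: realizes_Nil)
  next
    case (insert j J)
    then obtain \<pi> where \<pi>: "set \<pi> \<subseteq> L" "\<And>v. \<exists>w X. map fst w = \<pi> \<and> realizes w X \<and>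
      (\<forall>i\<in>I. X (p i) = (if i \<in> J then v i else (0, 0)))" by auto
    have "j \<in> I" using insert by simp
    from tangent_field_delta[OF assms(1,2) I(1) this a]
    obtain U where "tangent_field L U"
      and U: "U (p j) = (a, 1)" "\<forall>i\<in>I - {j}. U (p i) = (0, 0)" by (elim exE conjE)
    then obtain u where u: "fst ` set u \<subseteq> L" "realizes u U"
      unfolding tangent_field_def by blast
    from tangent_field_delta[OF assms(1,2) I(1) \<open>j \<in> I\<close> b]
    obtain V where "tangent_field L V"
      and V: "V (p j) = (b, 1)" "\<forall>i\<in>I - {j}. V (p i) = (0, 0)" by (elim exE conjE)
    then obtain v where v: "fst ` set v \<subseteq> L" "realizes v V"
      unfolding tangent_field_def by blast
    show ?case
    proof (intro exI[of _ "map fst u @ map fst v @ \<pi>"] conjI allI)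
      show "set (map fst u @ map fst v @ \<pi>) \<subseteq> L" using u v \<pi> by auto
      fix z
      obtain w X where w: "map fst w = \<pi>" "realizes w X"
        "\<And>i. i \<in> I \<Longrightarrow> X (p i) = (if i \<in> J then z i else (0, 0))" using \<pi>(2)[of z] by blast
      \<comment> \<open>Cramer's rule: \<open>s\<close> and \<open>t\<close> are the coordinates of
        \<open>z j\<close> in the basis \<open>(a, 1)\<close>, \<open>(b, 1)\<close>.\<close>
      define s where "s = (b * snd (z j) - fst (z j)) / (b - a)"
      define t where "t = (fst (z j) - a * snd (z j)) / (b - a)"
      have st: "s * a + t * b = fst (z j)" "s + t = snd (z j)"
        using \<open>b \<noteq> a\<close> by (simp_all add: s_def t_def divide_simps) (simp_all add: algebra_simps)
      show "\<exists>w X. map fst w = map fst u @ map fst v @ \<pi> \<and> realizes w X \<and>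
        (\<forall>i\<in>I. X (p i) = (if i \<in> insert j J then z i else (0, 0)))"
      proof (intro exI conjI)
        \<comment> \<open>Reparametrisation changes only the coefficients, so the letters of
          \<open>u\<close> and \<open>v\<close> serve every \<open>z\<close>.\<close>
        show "realizes (reparam s u @ reparam t v @ w) (\<lambda>y. (s * fst (U y) + (t * fst (V y) + fst (X y)),
            s * snd (U y) + (t * snd (V y) + snd (X y))))"
          using realizes_append[OF realizes_reparam[OF u(2)] realizes_append[OF realizes_reparam[OF v(2)] w(2)], of s t]
          by simp
        show "map fst (reparam s u @ reparam t v @ w) = map fst u @ map fst v @ \<pi>"
          by (simp add: map_fst_reparam w)
        show "\<forall>i\<in>I. (s * fst (U (p i)) + (t * fst (V (p i)) + fst (X (p i))),
            s * snd (U (p i)) + (t * snd (V (p i)) + snd (X (p i)))) =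
            (if i \<in> insert j J then z i else (0, 0))"
        proof
          fix i assume "i \<in> I"
          show "(s * fst (U (p i)) + (t * fst (V (p i)) + fst (X (p i))),
            s * snd (U (p i)) + (t * snd (V (p i)) + snd (X (p i)))) =
            (if i \<in> insert j J then z i else (0, 0))"
          proof (cases "i = j")
            case True
            then show ?thesis using insert.hyps U(1) V(1) w(3)[of j] st \<open>j \<in> I\<close> by (simp add: prod_eq_iff)
          next
            case False
            then show ?thesis using U(2) V(2) w(3)[of i] \<open>i \<in> I\<close> by (auto simp: prod_eq_iff)
          qed
        qed
      qed
    qed
  qed
  from this[OF I(1) order_refl] show ?thesis by simp
qed

section \<open>Orbits of tuples\<close>

definition pattern_image ::
    "'i set \<Rightarrow> ('i \<Rightarrow> 'a::comm_ring_1 \<times> 'a) \<Rightarrow> nat option list \<Rightarrow> ('i \<Rightarrow> 'a \<times> 'a) set" where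
  "pattern_image I p \<pi> = {x. \<exists>w. map fst w = \<pi> \<and> (\<forall>i\<in>I. x i = act w (p i))}"

text \<open>Undoing the outermost letter exhibits the image as the projection of a preimage, the
  form covered by the closure lemmas for constructible sets. The sign of \<open>a\<close> is
  absorbed by the quantifier.\<close>

lemma pattern_image_Cons:
  "pattern_image I p (l # \<pi>) = {x. \<exists>a. (\<lambda>i. shear l a (x i)) \<in> pattern_image I p \<pi>}"
proof (rule Set.set_eqI, rule iffI)
  fix x assume "x \<in> pattern_image I p (l # \<pi>)"
  then obtain w where w: "map fst w = l # \<pi>" "\<forall>i\<in>I. x i = act w (p i)"
    unfolding pattern_image_def by (elim CollectE exE conjE)
  then obtain a v where v: "w = (l, a) # v" "map fst v = \<pi>" by (cases w) auto
  then have "\<forall>i\<in>I. shear l (- a) (x i) = act v (p i)" using w(2) by (auto simp: shear_minus)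
  then show "x \<in> {x. \<exists>a. (\<lambda>i. shear l a (x i)) \<in> pattern_image I p \<pi>}"
    using v(2) unfolding pattern_image_def by blast
next
  fix x assume "x \<in> {x. \<exists>a. (\<lambda>i. shear l a (x i)) \<in> pattern_image I p \<pi>}"
  then obtain a w where w: "map fst w = \<pi>" "\<forall>i\<in>I. shear l a (x i) = act w (p i)"
    unfolding pattern_image_def by blast
  then have "\<forall>i\<in>I. x i = act ((l, - a) # w) (p i)"
    by (metis act.simps(2) fst_conv snd_conv shear_minus(2))
  moreover have "map fst ((l, - a) # w) = l # \<pi>" using w by simp
  ultimately show "x \<in> pattern_image I p (l # \<pi>)"
    unfolding pattern_image_def by (intro CollectI exI conjI)
qed

lemma constructible_pattern_image:
  fixes p :: "'i \<Rightarrow> 'a::{alg_closed_field,field_char_0} \<times> 'a"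
  assumes "finite I"
  shows "pattern_image I p \<pi> \<in> pp.constructible I"
proof (induction \<pi>)
  case Nil
  have "{x. \<forall>i\<in>J. x i = p i} \<in> pp.constructible I" if "finite J" "J \<subseteq> I" for J
    using that
  proof (induction J)
    case empty
    show ?case using pp.constructible_UNIV by simp
  next
    case (insert j J)
    then have "(\<lambda>x. fst (x j) - fst (p j)) \<in> point_polys I" "(\<lambda>x. snd (x j) - snd (p j)) \<in> point_polys I"
      by (auto intro: pp.diff point_polys.intros)
    then have "{x. fst (x j) - fst (p j) = 0} \<inter> {x. snd (x j) - snd (p j) = 0} \<inter> {x. \<forall>i\<in>J. x i = p i}
        \<in> pp.constructible I"
      using insert by (intro pp.constructible.Int pp.zeros) auto
    moreover have "{x. fst (x j) - fst (p j) = 0} \<inter> {x. snd (x j) - snd (p j) = 0} \<inter> {x. \<forall>i\<in>J. x i = p i}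
        = {x. \<forall>i\<in>insert j J. x i = p i}" by (auto simp: prod_eq_iff)
    ultimately show ?case by simp
  qed
  from this[OF assms order_refl] show ?case by (simp add: pattern_image_def)
next
  case (Cons l \<pi>)
  have "\<exists>n P. pp.poly_family I n P \<and> (\<forall>x t. fst (shear l t (x i)) = poly (P x) t)"
    "\<exists>n P. pp.poly_family I n P \<and> (\<forall>x t. snd (shear l t (x i)) = poly (P x) t)" if "i \<in> I" for i
  proof -
    have fst: "(\<lambda>x. fst (x i)) \<in> point_polys I" and snd: "(\<lambda>x. snd (x i)) \<in> point_polys I"
      using that by (auto intro: point_polys.intros)
    have pow: "(\<lambda>x. fst (x i) ^ e) \<in> point_polys I" for e
      by (induction e) (auto intro: point_polys.intros fst)
    have zero: "(\<lambda>_. 0) \<in> point_polys I" by (rule point_polys.const)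
    show "\<exists>n P. pp.poly_family I n P \<and> (\<forall>x t. fst (shear l t (x i)) = poly (P x) t)"
      using poly_family_linear[OF fst zero] poly_family_linear[OF fst snd]
      by (cases l) (fastforce simp: shear_def)+
    show "\<exists>n P. pp.poly_family I n P \<and> (\<forall>x t. snd (shear l t (x i)) = poly (P x) t)"
    proof (cases l)
      case None
      with poly_family_linear[OF snd zero] show ?thesis by (fastforce simp: shear_def)
    next
      case (Some e)
      with poly_family_linear[OF snd pow[of e]] show ?thesis by (fastforce simp: shear_def)
    qed
  qed
  note subst = point_polys_substitution[where \<sigma> = "\<lambda>t x i. shear l t (x i)", OF this]
  have "{x. \<exists>t. (x, t) \<in> {(x, t). (\<lambda>i. shear l t (x i)) \<in> pattern_image I p \<pi>}} \<in> pp.constructible I"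
    by (intro pp.constructible_projection pp.constructible_over_vimage[OF Cons.IH] subst)
  then show ?case by (simp add: pattern_image_Cons)
qed

text \<open>The image contains curves through \<open>p\<close> with every velocity, so no nonzero
  function vanishes on it and the thin alternative is excluded.\<close>

lemma pattern_image_thick:
  fixes p :: "'i \<Rightarrow> 'a::{alg_closed_field,field_char_0} \<times> 'a"
  assumes "finite I" and \<pi>: "\<forall>v. \<exists>w X. map fst w = \<pi> \<and> realizes w X \<and> (\<forall>i\<in>I. X (p i) = v i)"
  shows "\<exists>f\<in>point_polys I. (\<exists>x. f x \<noteq> 0) \<and> (\<forall>x. f x \<noteq> 0 \<longrightarrow> x \<in> pattern_image I p \<pi>)"
proof -
  let ?S = "pattern_image I p \<pi>"
  have "\<exists>x\<in>?S. f x \<noteq> 0" if f: "f \<in> point_polys I" "\<exists>x. f x \<noteq> 0" for f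
  proof (rule point_polys_nonzero_on_curves[OF f])
    fix v :: "'i \<Rightarrow> 'a \<times> 'a"
    obtain w X where w: "map fst w = \<pi>" "realizes w X" "\<And>i. i \<in> I \<Longrightarrow> X (p i) = v i" using \<pi> by blast
    \<comment> \<open>The curve of words is applied to the constant curve at \<open>p i\<close>,
      whose own velocity is zero.\<close>
    define z where "z = (\<lambda>i. act w ([:fst (p i):], [:snd (p i):]))"
    have "reparam 1 w = w" by (simp add: reparam_def pcompose_idR case_prod_unfold)
    then have z: "eval_curve (z i) 0 = p i" "velocity (z i) = X (p i)" for i
      using realizesD[OF w(2), of 1 "([:fst (p i):], [:snd (p i):])"]
      by (simp_all add: z_def eval_curve_def velocity_def)
    have "(\<lambda>i. eval_curve (z i) s) \<in> ?S" for s
      unfolding pattern_image_def z_def eval_curve_act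
      by (intro CollectI exI[of _ "map (\<lambda>(l, a). (l, poly a s)) w"])
        (use w(1) in \<open>auto simp: eval_curve_def\<close>)
    then show "\<exists>X Y. (\<forall>i\<in>I. poly (X i) 0 = fst (p i) \<and> poly (Y i) 0 = snd (p i) \<and>
        poly (pderiv (X i)) 0 = fst (v i) \<and> poly (pderiv (Y i)) 0 = snd (v i)) \<and>
      (\<forall>s. (\<lambda>i. (poly (X i) s, poly (Y i) s)) \<in> ?S)"
      using z w(3)
      by (intro exI[of _ "\<lambda>i. fst (z i)"] exI[of _ "\<lambda>i. snd (z i)"])
        (auto simp: eval_curve_def velocity_def prod_eq_iff)
  qed
  moreover have "\<exists>f\<in>point_polys I. (\<exists>x. f x \<noteq> 0) \<and>
      ((\<forall>x\<in>?S. f x = 0) \<or> (\<forall>x. f x \<noteq> 0 \<longrightarrow> x \<in> ?S))"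
    by (rule pp.constructible_thin_or_thick[OF point_polys_no_zero_divisors
          constructible_pattern_image[OF assms(1)]])
  ultimately show ?thesis by metis
qed

text \<open>The two images contain complements of hypersurfaces, which meet. From a common tuple,
  the inverse of \<open>act v\<close> after \<open>act u\<close> carries \<open>p\<close> to
  \<open>q\<close>.\<close>

lemma words_infinitely_transitive:
  fixes p q :: "'i \<Rightarrow> 'a::{alg_closed_field,field_char_0} \<times> 'a"
  assumes "None \<in> L" "Some d \<in> L" "\<And>e. Some e \<in> L \<Longrightarrow> e \<ge> 1"
    and "\<And>g. (\<And>e. Some e \<in> L \<Longrightarrow> g dvd e - 1) \<Longrightarrow> g dvd 1"
    and "finite I" and p: "inj_on p I" "(0, 0) \<notin> p ` I" and q: "inj_on q I" "(0, 0) \<notin> q ` I"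
  shows "\<exists>u v. fst ` set u \<subseteq> L \<and> fst ` set v \<subseteq> L \<and> (\<forall>i\<in>I. act u (p i) = act v (q i))"
proof -
  obtain N0 where N0: "\<forall>N\<ge>N0. tangent_field L (\<lambda>(x, y). (0, x ^ N :: 'a))"
    using tangent_field_powers[OF assms(1-4)] by blast
  obtain \<pi> where \<pi>: "set \<pi> \<subseteq> L"
      "\<forall>v. \<exists>w X. map fst w = \<pi> \<and> realizes w X \<and> (\<forall>i\<in>I. X (p i) = v i)"
    using realizes_all_velocities[OF assms(1) N0 assms(5) p] by (elim exE conjE)
  obtain \<rho> where \<rho>: "set \<rho> \<subseteq> L"
      "\<forall>v. \<exists>w X. map fst w = \<rho> \<and> realizes w X \<and> (\<forall>i\<in>I. X (q i) = v i)"
    using realizes_all_velocities[OF assms(1) N0 assms(5) q] by (elim exE conjE)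
  obtain f where f: "f \<in> point_polys I" "\<exists>x. f x \<noteq> 0" "\<And>x. f x \<noteq> 0 \<Longrightarrow> x \<in> pattern_image I p \<pi>"
    using pattern_image_thick[OF assms(5) \<pi>(2)] by blast
  obtain g where g: "g \<in> point_polys I" "\<exists>x. g x \<noteq> 0" "\<And>x. g x \<noteq> 0 \<Longrightarrow> x \<in> pattern_image I q \<rho>"
    using pattern_image_thick[OF assms(5) \<rho>(2)] by blast
  obtain x where "f x * g x \<noteq> 0"
    using point_polys_no_zero_divisors[OF f(1) g(1) f(2) g(2)] by blast
  then have "x \<in> pattern_image I p \<pi>" "x \<in> pattern_image I q \<rho>" using f(3) g(3) by auto
  then obtain u v where uv: "map fst u = \<pi>" "map fst v = \<rho>"
    "\<forall>i\<in>I. x i = act u (p i)" "\<forall>i\<in>I. x i = act v (q i)" unfolding pattern_image_def by blast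
  have "fst ` set u \<subseteq> L" "fst ` set v \<subseteq> L" using uv(1,2) \<pi>(1) \<rho>(1) by (metis list.set_map)+
  then show ?thesis using uv(3,4) by (intro exI[of _ u] exI[of _ v]) auto
qed

section \<open>Scalings that commute with the group, and the equivalence\<close>

lemma exists_nontrivial_scaling:
  assumes "k \<noteq> 1"
  shows "\<exists>\<epsilon> :: 'a::{alg_closed_field,field_char_0}. \<epsilon> \<noteq> 0 \<and> \<epsilon> \<noteq> 1 \<and> (\<forall>e. k dvd e \<longrightarrow> \<epsilon> ^ e = 1)"
proof (cases "k = 0")
  case True
  \<comment> \<open>\<open>0 dvd e\<close> holds only for \<open>e = 0\<close>, so any scalar other
    than 0 and 1 works.\<close>
  then show ?thesis by (intro exI[of _ 2]) auto
next
  case False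
  with assms have k: "k > 1" by simp
  \<comment> \<open>A root of the sum of \<open>t ^ j\<close> for \<open>j < k\<close> is a
    \<open>k\<close>-th root of unity. It is not 1, where the sum is \<open>k\<close>, nonzero in
    characteristic zero.\<close>
  have "\<exists>\<epsilon> :: 'a. (\<Sum>j\<le>k - 1. 1 * \<epsilon> ^ j) = 0"
    using k by (intro alg_closed) auto
  then obtain \<epsilon> :: 'a where \<epsilon>: "(\<Sum>j\<le>k - 1. \<epsilon> ^ j) = 0" by auto
  have "{..k - 1} = {..<k}" using k by auto
  then have sum: "(\<Sum>j<k. \<epsilon> ^ j) = 0" using \<epsilon> by simp
  have "\<epsilon> ^ k = 1" using power_diff_1_eq[of \<epsilon> k] sum by simp
  moreover have "\<epsilon> \<noteq> 1" using sum k by auto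
  ultimately show ?thesis using k by (intro exI[of _ \<epsilon>]) (auto elim!: dvdE simp: power_mult power_0_left)
qed

text \<open>By \<open>group_action_punctured_plane_iff\<close> the third assumption says that no
  \<open>d i\<close> is 0. The gcd is taken over \<open>int\<close>, where a zero exponent would
  contribute -1.\<close>

theorem theorem1:
  fixes d :: "nat \<Rightarrow> nat" and m :: nat
    and G :: "('a::{alg_closed_field, field_char_0} \<times> 'a \<Rightarrow> 'a \<times> 'a) monoid"
  assumes "m \<ge> 1"
    and "G = subgroup_generated Aut_plane (H 1 \<union> (\<Union>i\<in>{1..m}. K (d i)))"
    and "group_action G punctured_plane (\<lambda>g. restrict g punctured_plane)"
  shows "infinitely_transitive_action G punctured_plane (\<lambda>g. restrict g punctured_plane)
           \<longleftrightarrow> (GCD i\<in>{1..m}. int (d i) - 1) = 1"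
proof -
  define S :: "('a \<times> 'a \<Rightarrow> 'a \<times> 'a) set" where "S = H 1 \<union> (\<Union>i\<in>{1..m}. K (d i))"
  interpret A: group "Aut_plane :: ('a \<times> 'a \<Rightarrow> 'a \<times> 'a) monoid" by (rule group_Aut_plane)
  have S: "S \<subseteq> carrier Aut_plane"
    using H_subset_Aut_plane K_subset_Aut_plane by (auto simp: S_def)
  have carr: "carrier G = generate Aut_plane S"
    by (simp only: assms(2) S_def[symmetric] carrier_subgroup_generated Int_absorb1[OF S])
  have pos: "d i \<noteq> 0" if "i \<in> {1..m}" for i
    using assms(3) that group_action_punctured_plane_iff[of d m, where ?'a = 'a]
    by (simp add: assms(2))
  \<comment> \<open>Since no \<open>d i\<close> is 0, truncated subtraction agrees with the integer
    one.\<close>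
  define k where "k = (GCD i\<in>{1..m}. d i - 1)"
  have "(GCD i\<in>{1..m}. int (d i) - 1) = (GCD i\<in>{1..m}. int (d i - 1))"
    using pos by (intro arg_cong[of _ _ Gcd] image_cong) (auto simp: of_nat_diff Suc_leI)
  also have "\<dots> = int k"
    by (simp add: k_def Gcd_int_def image_image)
  finally have gcd_eq: "(GCD i\<in>{1..m}. int (d i) - 1) = 1 \<longleftrightarrow> k = 1" by simp
  have k_dvd: "k dvd d i - 1" if "i \<in> {1..m}" for i
    unfolding k_def using that by (intro Gcd_dvd) auto
  have "k = 1" if trans: "infinitely_transitive_action G punctured_plane (\<lambda>g. restrict g punctured_plane)"
  proof (rule ccontr)
    assume "k \<noteq> 1"
    then obtain \<epsilon> :: 'a where \<epsilon>: "\<epsilon> \<noteq> 0" "\<epsilon> \<noteq> 1" "\<And>e. k dvd e \<Longrightarrow> \<epsilon> ^ e = 1"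
      using exists_nontrivial_scaling by blast
    define s where "s = (\<lambda>v :: 'a \<times> 'a. (\<epsilon> * fst v, \<epsilon> * snd v))"
    have \<epsilon>d: "\<epsilon> ^ d i = \<epsilon>" if "i \<in> {1..m}" for i
      using \<epsilon>(3)[OF k_dvd[OF that]] pos[OF that] by (cases "d i") auto
    have Ss: "h (s v) = s (h v)" if "h \<in> S" for h v
      using that \<epsilon>d
      by (auto simp: S_def H_def K_def s_def power_mult_distrib case_prod_unfold algebra_simps)
    have comm: "g (s v) = s (g v)" if "g \<in> generate Aut_plane S" for g v
      using that
    proof (induction arbitrary: v)
      case (inv h)
      let ?h = "inv\<^bsub>Aut_plane\<^esub> h"
      have "?h \<circ> h = id" "h \<circ> ?h = id"
        using A.l_inv[of h] A.r_inv[of h] inv S by (auto simp: Aut_plane_def)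
      then have hh: "?h (h u) = u" "h (?h u) = u" for u by (metis comp_apply id_apply)+
      have "?h (s v) = ?h (s (h (?h v)))" by (simp add: hh)
      also have "\<dots> = ?h (h (s (?h v)))" by (simp add: Ss[OF inv])
      finally show ?case by (simp add: hh)
    qed (auto simp: Aut_plane_def Ss)
    \<comment> \<open>Two proportional vectors are to be sent to two linearly independent ones,
      which is impossible for a map commuting with the scaling \<open>s\<close>.\<close>
    define p where "p = (\<lambda>i :: nat. if i = 1 then (1, 0) else (\<epsilon>, 0) :: 'a \<times> 'a)"
    define q where "q = (\<lambda>i :: nat. if i = 1 then (1, 0) else (1, 1) :: 'a \<times> 'a)"
    have "\<exists>g\<in>carrier G. \<forall>i\<in>{1..2}. restrict g punctured_plane (p i) = q i"
      by (rule infinitely_transitive_action.infinitely_transitive[OF trans])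
        (use \<epsilon> in \<open>auto simp: p_def q_def inj_on_def punctured_plane_def split: if_splits\<close>)
    then obtain g where g: "g \<in> carrier G" "\<And>i. i \<in> {1..2} \<Longrightarrow> restrict g punctured_plane (p i) = q i" by blast
    have "g (1, 0) = (1, 0)" "g (\<epsilon>, 0) = (1, 1)"
      using g(2)[of 1] g(2)[of 2] \<epsilon>(1) by (auto simp: p_def q_def punctured_plane_def)
    moreover have "g (\<epsilon>, 0) = s (g (1, 0))" using comm[of g "(1, 0)"] g(1) carr by (simp add: s_def)
    ultimately show False by (simp add: s_def)
  qed
  moreover have "infinitely_transitive_action G punctured_plane (\<lambda>g. restrict g punctured_plane)" if "k = 1"
    unfolding infinitely_transitive_action_def infinitely_transitive_action_axioms_def
  proof (intro conjI allI impI assms(3))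
    fix n :: nat and p q :: "nat \<Rightarrow> 'a \<times> 'a"
    assume p: "inj_on p {1..n}" "p ` {1..n} \<subseteq> punctured_plane"
      and q: "inj_on q {1..n}" "q ` {1..n} \<subseteq> punctured_plane"
    define L where "L = insert None ((\<lambda>i. Some (d i)) ` {1..m})"
    have act_in: "act w \<in> generate Aut_plane S" if "fst ` set w \<subseteq> L" for w
      using that
    proof (induction w)
      case Nil
      have "(act [] :: 'a \<times> 'a \<Rightarrow> 'a \<times> 'a) = \<one>\<^bsub>Aut_plane\<^esub>" by (auto simp: Aut_plane_def)
      then show ?case by (simp only: generate.one)
    next
      case (Cons la w)
      have "shear l a \<in> S" if "l \<in> L" for l a
      proof (cases l)
        case None
        then have "shear l a = (\<lambda>(x, y). (x + a * y ^ 1, y))" by (auto simp: shear_def fun_eq_iff)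
        then show ?thesis unfolding S_def H_def by blast
      next
        case (Some e)
        then have "shear l a = (\<lambda>(x, y). (x, y + a * x ^ e))" by (auto simp: shear_def fun_eq_iff)
        then have "shear l a \<in> K e" unfolding K_def by blast
        then show ?thesis using that Some by (auto simp: S_def L_def)
      qed
      then have "shear (fst la) (snd la) \<otimes>\<^bsub>Aut_plane\<^esub> act w \<in> generate Aut_plane S"
        using Cons by (intro generate.eng[OF generate.incl]) auto
      moreover have "act (la # w) = shear (fst la) (snd la) \<otimes>\<^bsub>Aut_plane\<^esub> act w"
        by (simp add: Aut_plane_def fun_eq_iff)
      ultimately show ?case by (simp only:)
    qed
    have "\<exists>u v. fst ` set u \<subseteq> L \<and> fst ` set v \<subseteq> L \<and> (\<forall>i\<in>{1..n}. act u (p i) = act v (q i))"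
    proof (rule words_infinitely_transitive)
      show "Some (d 1) \<in> L" using assms(1) by (auto simp: L_def)
      show "e \<ge> 1" if "Some e \<in> L" for e using that pos by (auto simp: L_def Suc_le_eq)
      show "g dvd 1" if "\<And>e. Some e \<in> L \<Longrightarrow> g dvd e - 1" for g
      proof -
        have "g dvd k" unfolding k_def by (rule Gcd_greatest) (use that in \<open>auto simp: L_def\<close>)
        then show ?thesis using \<open>k = 1\<close> by simp
      qed
    qed (use p q in \<open>auto simp: L_def punctured_plane_def\<close>)
    then obtain u v where uv: "fst ` set u \<subseteq> L" "fst ` set v \<subseteq> L"
      "\<forall>i\<in>{1..n}. act u (p i) = act v (q i)" by (elim exE conjE)
    let ?v = "inv\<^bsub>Aut_plane\<^esub> act v"
    have "act v \<in> carrier Aut_plane" using act_in[OF uv(2)] A.generate_in_carrier[OF S] by blast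
    then have "?v \<circ> act v = id" using A.l_inv[of "act v"] by (simp add: Aut_plane_def)
    then have inv: "?v (act v z) = z" for z by (metis comp_apply id_apply)
    have "?v \<in> generate Aut_plane S" using A.generate_m_inv_closed[OF S act_in[OF uv(2)]] .
    then have "?v \<otimes>\<^bsub>Aut_plane\<^esub> act u \<in> carrier G"
      unfolding carr by (rule generate.eng) (rule act_in[OF uv(1)])
    then have "?v \<circ> act u \<in> carrier G" by (simp add: Aut_plane_def)
    moreover have "\<forall>i\<in>{1..n}. restrict (?v \<circ> act u) punctured_plane (p i) = q i"
      using p(2) uv(3) inv by auto
    ultimately show "\<exists>g\<in>carrier G. \<forall>i\<in>{1..n}. restrict g punctured_plane (p i) = q i" by blast
  qed
  ultimately show ?thesis using gcd_eq by blast
qed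

end
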